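(* Let $\mathfrak{M}$ be a $t$-finite dual $t$-motive with $\bar{K}[t]$-basis $\boldsymbol{e}=(e_1,\ldots, e_r)$ and let $\tilde{\Theta}\in \mathrm{Mat}_{r\times r}(\bar{K}[t])$ be the matrix such that $\sigma(\boldsymbol{e})=\boldsymbol{e}\cdot \tilde{\Theta}$. Let $k\ge 0$. Then \[\boldsymbol{De}=(D_0e_1,\ldots, D_0e_r, D_1e_1,\ldots, D_1e_r,\ldots, D_ke_1,\ldots, D_ke_r)\] is a $\bar{K}[t]$-basis of the $k$-th prolongation $\rho_k\mathfrak{M}$ and \[ \sigma(\boldsymbol{De})=\boldsymbol{De}\cdot \rho_{[k]}(\tilde{\Theta}). \] If $\mathfrak{M}$ is rigid analytically trivial with rigid analytic trivialization $\Psi$, i.e. $\Psi\in\mathrm{GL}_r(\mathbb{T})$ and $\Psi^\sigma = \Psi\cdot \tilde{\Theta}$, then $\rho_k\mathfrak{M}$ is rigid analytically trivial and $\rho_{[k]}(\Psi)$ is a rigid analytic trivialization with respect to $\boldsymbol{De}$.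
   Context: Let $K$ be a finite extension of $\mathbb{F}_q(\theta)$, with an absolute value $|\cdot|_\infty$ extending the one with $|\theta|_\infty=q$; $\mathbb{C}_\infty$ is the completion of an algebraic closure of the completion $K_\infty$, and $\bar K$ is the algebraic closure of $K$ in $\mathbb{C}_\infty$. $\mathbb{T}\subset\mathbb{C}_\infty[[t]]$ is the Tate algebra of power series converging for $|t|_\infty\le1$. For $f=\sum x_it^i\in\mathbb{C}_\infty((t))$ put $f^\sigma=\sum x_i^{1/q}t^i$ (entry-wise on matrices). $\bar K[t]\{\sigma\}$ is the skew polynomial ring with $\sigma a=a^\sigma\sigma$ for $a\in\bar K[t]$, and $\bar K\{\sigma\}$ the corresponding subring over $\bar K$. A dual $t$-motive $\mathfrak{M}$ is a left $\bar K[t]\{\sigma\}$-module that is free and finitely generated as a $\bar K\{\sigma\}$-module and such that $(t-\theta)^\ell\mathfrak{M}\subseteq\sigma(\mathfrak{M})$ for some $\ell\in\mathbb{N}$. It is $t$-finite if it is also finitely generated (hence free) as a $\bar K[t]$-module. With respect to a $\bar K[t]$-basis $\boldsymbol e$ with $\sigma(\boldsymbol e)=\boldsymbol e\cdot\tilde\Theta$ (i.e. $\sigma(e_j)=\sum_h\tilde\Theta_{hj}e_h$), a rigid analytic trivialization is a matrix $\Psi\in\mathrm{GL}_r(\mathbb{T})$ with $\Psi\cdot\tilde\Theta=\Psi^\sigma$; $\mathfrak{M}$ is rigid analytically trivial if such $\Psi$ exists. Hyperdifferential operators: $\mathbb{C}_\infty$-linear maps on $\mathbb{C}_\infty((t))$,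 $\partial_t^{(n)}(\sum x_it^i)=\sum\binom{i}{n}x_it^{i-n}$, applied entry-wise to matrices. For $\Theta\in\mathrm{Mat}_{r\times r}(\mathbb{C}_\infty((t)))$, $\rho_{[k]}(\Theta)\in\mathrm{Mat}_{r(k+1)\times r(k+1)}(\mathbb{C}_\infty((t)))$ is the block upper triangular matrix whose $(i,j)$ block ($0\le i,j\le k$) is $\partial_t^{(j-i)}(\Theta)$ if $j\ge i$ and $0$ otherwise. Prolongation: $\rho_k\mathfrak{M}$ is the $\bar K[t]$-module generated by symbols $D_im$ ($i=0,\dots,k$, $m\in\mathfrak{M}$) subject to $D_i(m_1+m_2)=D_im_1+D_im_2$ and $D_i(am)=\sum_{i_1+i_2=i}\partial_t^{(i_1)}(a)\cdot D_{i_2}m$ for all $m,m_1,m_2\in\mathfrak{M}$, $a\in\bar K[t]$, with semilinear action $\sigma(a\cdot D_im)=a^\sigma\cdot D_i(\sigma(m))$. *)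

theory Defs
  imports
    "HOL-Algebra.Algebra"
    "HOL-Algebra.Algebraic_Closure_Type"
    "HOL-Analysis.Analysis"
    "Jordan_Normal_Form.Matrix"
begin

no_notation fls_nth (infixl \<open>$$\<close> 75)

section \<open>The fields\<close>

text \<open>
  The type \<open>'c\<close> plays the role of \<open>\<complex>\<^sub>\<infinity>\<close>; all other fields are subsets of it.  Rings inside
  \<open>\<complex>\<^sub>\<infinity>((t))\<close>, such as \<open>Kbar[t]\<close> and the Tate algebra, are subsets of \<^typ>\<open>'c fls\<close>, and
  \<open>ring_on S\<close> is the ring structure on such a subset.
\<close>

definition ring_on :: "'a::comm_ring_1 set \<Rightarrow> 'a ring" where
  "ring_on S = ring_of_type_algebra \<lparr>carrier := S\<rparr>"

definition av_topology :: "('c::field \<Rightarrow> real) \<Rightarrow> 'c topology" where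
  "av_topology absv = Metric_space.mtopology UNIV (\<lambda>x y. absv (x - y))"

definition av_complete :: "('c::field \<Rightarrow> real) \<Rightarrow> bool" where
  "av_complete absv \<longleftrightarrow> Metric_space.mcomplete UNIV (\<lambda>x y. absv (x - y))"

text \<open>
  \<open>generate_field ring_of_type_algebra (insert \<theta> Fq)\<close> is \<open>\<bbbF>\<^sub>q(\<theta>)\<close>.  The conditions on the absolute
  value force it to be trivial on \<open>\<bbbF>\<^sub>q\<close> and \<open>\<theta>\<close> to be transcendental, so that it restricts to
  \<open>q\<close> to the degree on \<open>\<bbbF>\<^sub>q(\<theta>)\<close>.  Since \<open>\<complex>\<^sub>\<infinity>\<close> is complete, the completion \<open>K\<^sub>\<infinity>\<close> is the
  closure of \<open>K\<close>, and being a completion of \<open>L\<close> means being complete with \<open>L\<close> dense.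
\<close>

locale function_field_setting =
  fixes q :: nat and Fq :: "'c::field set" and \<theta> :: 'c and K :: "'c set"
    and absv :: "'c \<Rightarrow> real"
  assumes Fq: "subfield Fq ring_of_type_algebra" "finite Fq" "card Fq = q"
    and absv_nonneg: "\<And>x. 0 \<le> absv x"
    and absv_eq_0_iff: "\<And>x. absv x = 0 \<longleftrightarrow> x = 0"
    and absv_mult: "\<And>x y. absv (x * y) = absv x * absv y"
    and absv_add: "\<And>x y. absv (x + y) \<le> max (absv x) (absv y)"
    and absv_theta: "absv \<theta> = real q"
    and K: "subfield K ring_of_type_algebra"
      "generate_field ring_of_type_algebra (insert \<theta> Fq) \<subseteq> K"
      "ring.finite_dimension ring_of_type_algebra
        (generate_field ring_of_type_algebra (insert \<theta> Fq)) K"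
    and complete: "av_complete absv"
    and completion_of_closure:
      "\<exists>L. algebraic_closure (ring_on L) (av_topology absv closure_of K)
         \<and> av_topology absv closure_of L = UNIV"

definition Kbar :: "'c::field set \<Rightarrow> 'c set" where
  "Kbar K = {x. (ring.algebraic ring_of_type_algebra over K) x}"


section \<open>Subrings of the Laurent series field, twisting and hyperderivatives\<close>

definition Kbar_const :: "'c::field set \<Rightarrow> 'c fls set" where
  "Kbar_const K = fls_const ` Kbar K"

definition Kbar_t :: "'c::field set \<Rightarrow> 'c fls set" where
  "Kbar_t K = {fps_to_fls (fps_of_poly p) | p. \<forall>i. Polynomial.coeff p i \<in> Kbar K}"

definition tate_algebra :: "('c::field \<Rightarrow> real) \<Rightarrow> 'c fls set" where
  "tate_algebra absv = {f. (\<forall>n<0. fls_nth f n = 0) \<and>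
     (\<forall>z. absv z \<le> 1 \<longrightarrow>
       (\<exists>s. limitin (av_topology absv) (\<lambda>N. \<Sum>n<N. fls_nth f (int n) * z ^ n) s sequentially))}"

text \<open>In \<open>\<complex>\<^sub>\<infinity>\<close> every element has exactly one \<open>q\<close>-th root.\<close>

definition qth_root :: "nat \<Rightarrow> 'c::field \<Rightarrow> 'c" where
  "qth_root q x = (THE y. y ^ q = x)"

definition twist :: "nat \<Rightarrow> 'c::field fls \<Rightarrow> 'c fls" where
  "twist q f = Abs_fls (\<lambda>n. qth_root q (fls_nth f n))"

text \<open>
  The binomial coefficient of an integer; this is \<^const>\<open>gbinomial\<close> on \<^typ>\<open>int\<close>, which the
  type constraint on that constant excludes.
\<close>

definition int_binomial :: "int \<Rightarrow> nat \<Rightarrow> int" where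
  "int_binomial i n = (\<Prod>j=0..<n. i - int j) div fact n"

definition hyperderiv :: "nat \<Rightarrow> 'c::field fls \<Rightarrow> 'c fls" where
  "hyperderiv n f =
     Abs_fls (\<lambda>j. of_int (int_binomial (j + int n) n) * fls_nth f (j + int n))"


section \<open>Left modules over not necessarily commutative rings\<close>

locale left_module = R?: ring R + M?: abelian_group M
  for R :: "('a, 'd) ring_scheme" and M :: "('a, 'b, 'e) module_scheme" (structure) +
  assumes smult_closed:
      "\<lbrakk>a \<in> carrier R; x \<in> carrier M\<rbrakk> \<Longrightarrow> a \<odot>\<^bsub>M\<^esub> x \<in> carrier M"
    and smult_l_distr:
      "\<lbrakk>a \<in> carrier R; b \<in> carrier R; x \<in> carrier M\<rbrakk> \<Longrightarrow>
        (a \<oplus>\<^bsub>R\<^esub> b) \<odot>\<^bsub>M\<^esub> x = a \<odot>\<^bsub>M\<^esub> x \<oplus>\<^bsub>M\<^esub> b \<odot>\<^bsub>M\<^esub> x"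
    and smult_r_distr:
      "\<lbrakk>a \<in> carrier R; x \<in> carrier M; y \<in> carrier M\<rbrakk> \<Longrightarrow>
        a \<odot>\<^bsub>M\<^esub> (x \<oplus>\<^bsub>M\<^esub> y) = a \<odot>\<^bsub>M\<^esub> x \<oplus>\<^bsub>M\<^esub> a \<odot>\<^bsub>M\<^esub> y"
    and smult_assoc:
      "\<lbrakk>a \<in> carrier R; b \<in> carrier R; x \<in> carrier M\<rbrakk> \<Longrightarrow>
        (a \<otimes>\<^bsub>R\<^esub> b) \<odot>\<^bsub>M\<^esub> x = a \<odot>\<^bsub>M\<^esub> (b \<odot>\<^bsub>M\<^esub> x)"
    and smult_one: "x \<in> carrier M \<Longrightarrow> \<one>\<^bsub>R\<^esub> \<odot>\<^bsub>M\<^esub> x = x"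

definition generates ::
    "('a, 'd) ring_scheme \<Rightarrow> ('a, 'b, 'e) module_scheme \<Rightarrow> 'i set \<Rightarrow> ('i \<Rightarrow> 'b) \<Rightarrow> bool" where
  "generates R M I e \<longleftrightarrow> e \<in> I \<rightarrow> carrier M \<and>
     (\<forall>m \<in> carrier M. \<exists>F c. finite F \<and> F \<subseteq> I \<and> c \<in> F \<rightarrow> carrier R \<and>
        m = (\<Oplus>\<^bsub>M\<^esub>i\<in>F. c i \<odot>\<^bsub>M\<^esub> e i))"

definition linearly_independent ::
    "('a, 'd) ring_scheme \<Rightarrow> ('a, 'b, 'e) module_scheme \<Rightarrow> 'i set \<Rightarrow> ('i \<Rightarrow> 'b) \<Rightarrow> bool" where
  "linearly_independent R M I e \<longleftrightarrow> e \<in> I \<rightarrow> carrier M \<and>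
     (\<forall>F c. finite F \<and> F \<subseteq> I \<and> c \<in> F \<rightarrow> carrier R \<and>
        (\<Oplus>\<^bsub>M\<^esub>i\<in>F. c i \<odot>\<^bsub>M\<^esub> e i) = \<zero>\<^bsub>M\<^esub> \<longrightarrow> (\<forall>i\<in>F. c i = \<zero>\<^bsub>R\<^esub>))"

definition is_basis ::
    "('a, 'd) ring_scheme \<Rightarrow> ('a, 'b, 'e) module_scheme \<Rightarrow> 'i set \<Rightarrow> ('i \<Rightarrow> 'b) \<Rightarrow> bool" where
  "is_basis R M I e \<longleftrightarrow> generates R M I e \<and> linearly_independent R M I e"

definition free_module :: "('a, 'd) ring_scheme \<Rightarrow> ('a, 'b, 'e) module_scheme \<Rightarrow> bool" where
  "free_module R M \<longleftrightarrow> (\<exists>B. is_basis R M B (\<lambda>b. b))"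

definition finitely_generated :: "('a, 'd) ring_scheme \<Rightarrow> ('a, 'b, 'e) module_scheme \<Rightarrow> bool" where
  "finitely_generated R M \<longleftrightarrow> (\<exists>B. finite B \<and> generates R M B (\<lambda>b. b))"


section \<open>Dual t-motives\<close>

text \<open>
  The skew polynomial \<open>\<Sum>\<^sub>i a\<^sub>i \<sigma>\<^sup>i\<close> is represented by its coefficient sequence \<open>(a\<^sub>i)\<^sub>i\<close>; the type
  \<^typ>\<open>'c fls poly\<close> is only used as the type of finitely supported sequences.  Thus
  \<open>monom 1 1\<close> is \<open>\<sigma>\<close> and \<open>[:a:]\<close> is the constant \<open>a\<close>.
\<close>

definition skew_mult :: "nat \<Rightarrow> 'c::field fls poly \<Rightarrow> 'c fls poly \<Rightarrow> 'c fls poly" where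
  "skew_mult q f g = (\<Sum>i\<le>Polynomial.degree f. \<Sum>j\<le>Polynomial.degree g.
     Polynomial.monom (Polynomial.coeff f i * (twist q ^^ i) (Polynomial.coeff g j)) (i + j))"

definition skew_poly_ring :: "nat \<Rightarrow> 'c::field fls set \<Rightarrow> 'c fls poly ring" where
  "skew_poly_ring q S =
     \<lparr>carrier = {f. \<forall>i. Polynomial.coeff f i \<in> S},
      monoid.mult = skew_mult q, one = 1, ring.zero = 0, add = (+)\<rparr>"

definition sigma :: "('c::field fls poly, 'm) module \<Rightarrow> 'm \<Rightarrow> 'm" where
  "sigma M m = Polynomial.monom 1 1 \<odot>\<^bsub>M\<^esub> m"

definition restrict_scalars :: "('c::field fls poly, 'm) module \<Rightarrow> ('c fls, 'm) module" where
  "restrict_scalars M =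
     \<lparr>carrier = carrier M, monoid.mult = monoid.mult M, one = monoid.one M, ring.zero = ring.zero M, add = add M,
      module.smult = (\<lambda>a m. [:a:] \<odot>\<^bsub>M\<^esub> m)\<rparr>"

definition dual_t_motive ::
    "nat \<Rightarrow> 'c::field \<Rightarrow> 'c set \<Rightarrow> ('c fls poly, 'm) module \<Rightarrow> bool" where
  "dual_t_motive q \<theta> K M \<longleftrightarrow>
     left_module (skew_poly_ring q (Kbar_t K)) M \<and>
     free_module (skew_poly_ring q (Kbar_const K)) M \<and>
     finitely_generated (skew_poly_ring q (Kbar_const K)) M \<and>
     (\<exists>l::nat. \<forall>m \<in> carrier M.
        (fls_X - fls_const \<theta>) ^ l \<odot>\<^bsub>restrict_scalars M\<^esub> m \<in> sigma M ` carrier M)"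

definition t_finite :: "'c::field set \<Rightarrow> ('c fls poly, 'm) module \<Rightarrow> bool" where
  "t_finite K M \<longleftrightarrow> finitely_generated (ring_on (Kbar_t K)) (restrict_scalars M)"

definition Kbar_t_basis ::
    "'c::field set \<Rightarrow> ('c fls poly, 'm) module \<Rightarrow> nat \<Rightarrow> (nat \<Rightarrow> 'm) \<Rightarrow> bool" where
  "Kbar_t_basis K M r e \<longleftrightarrow> is_basis (ring_on (Kbar_t K)) (restrict_scalars M) {..<r} e"

text \<open>\<open>\<sigma>(e) = e \<cdot> \<Theta>\<close> for the row \<open>e = (e\<^sub>0, \<dots>, e\<^sub>r\<^sub>-\<^sub>1)\<close>\<close>

definition sigma_matrix ::
    "'c::field set \<Rightarrow> ('c fls poly, 'm) module \<Rightarrow> nat \<Rightarrow> (nat \<Rightarrow> 'm) \<Rightarrow> 'c fls mat \<Rightarrow> bool" where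
  "sigma_matrix K M r e \<Theta> \<longleftrightarrow>
     \<Theta> \<in> carrier_mat r r \<and> elements_mat \<Theta> \<subseteq> Kbar_t K \<and>
     (\<forall>j<r. sigma M (e j) =
        (\<Oplus>\<^bsub>restrict_scalars M\<^esub>h\<in>{..<r}. \<Theta> $$ (h, j) \<odot>\<^bsub>restrict_scalars M\<^esub> e h))"

definition GL :: "nat \<Rightarrow> 'a::comm_ring_1 set \<Rightarrow> 'a mat set" where
  "GL r S = {A \<in> carrier_mat r r. elements_mat A \<subseteq> S \<and>
     (\<exists>B \<in> carrier_mat r r. elements_mat B \<subseteq> S \<and> A * B = 1\<^sub>m r \<and> B * A = 1\<^sub>m r)}"

definition rigid_analytic_trivialization ::
    "nat \<Rightarrow> 'c::field set \<Rightarrow> ('c \<Rightarrow> real) \<Rightarrow> ('c fls poly, 'm) module \<Rightarrow>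
     nat \<Rightarrow> (nat \<Rightarrow> 'm) \<Rightarrow> 'c fls mat \<Rightarrow> bool" where
  "rigid_analytic_trivialization q K absv M r e \<Psi> \<longleftrightarrow>
     Kbar_t_basis K M r e \<and>
     (\<exists>\<Theta>. sigma_matrix K M r e \<Theta> \<and>
        \<Psi> \<in> GL r (tate_algebra absv) \<and> \<Psi> * \<Theta> = map_mat (twist q) \<Psi>)"

definition rigid_analytically_trivial ::
    "nat \<Rightarrow> 'c::field set \<Rightarrow> ('c \<Rightarrow> real) \<Rightarrow> ('c fls poly, 'm) module \<Rightarrow> bool" where
  "rigid_analytically_trivial q K absv M \<longleftrightarrow>
     (\<exists>r e \<Psi>. rigid_analytic_trivialization q K absv M r e \<Psi>)"


section \<open>Prolongations\<close>

definition free_module_on :: "('a, 'd) ring_scheme \<Rightarrow> 'x set \<Rightarrow> ('a, 'x \<Rightarrow> 'a) module" where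
  "free_module_on R Y =
     \<lparr>carrier = {f. (\<forall>x. f x \<in> carrier R) \<and> (\<forall>x. x \<notin> Y \<longrightarrow> f x = \<zero>\<^bsub>R\<^esub>) \<and>
                    finite {x. f x \<noteq> \<zero>\<^bsub>R\<^esub>}},
      monoid.mult = undefined, one = undefined,
      ring.zero = (\<lambda>_. \<zero>\<^bsub>R\<^esub>), add = (\<lambda>f g x. f x \<oplus>\<^bsub>R\<^esub> g x),
      module.smult = (\<lambda>a f x. a \<otimes>\<^bsub>R\<^esub> f x)\<rparr>"

definition generated_submodule ::
    "('a, 'd) ring_scheme \<Rightarrow> ('a, 'b, 'e) module_scheme \<Rightarrow> 'b set \<Rightarrow> 'b set" where
  "generated_submodule R M S = \<Inter>{H. submodule H R M \<and> S \<subseteq> H}"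

definition quotient_module :: "('a, 'b) module \<Rightarrow> 'b set \<Rightarrow> ('a, 'b set) module" where
  "quotient_module M N =
     \<lparr>carrier = a_rcosets\<^bsub>M\<^esub> N, monoid.mult = undefined, one = undefined,
      ring.zero = N, add = set_add M,
      module.smult = (\<lambda>a Y. \<Union>x\<in>Y. N +>\<^bsub>M\<^esub> (a \<odot>\<^bsub>M\<^esub> x))\<rparr>"

text \<open>The pair \<open>(i, m)\<close> stands for the symbol \<open>D\<^sub>i m\<close>.\<close>

definition symbols_module ::
    "'c::field set \<Rightarrow> nat \<Rightarrow> ('c fls poly, 'm) module \<Rightarrow> ('c fls, nat \<times> 'm \<Rightarrow> 'c fls) module" where
  "symbols_module K k M = free_module_on (ring_on (Kbar_t K)) ({..k} \<times> carrier M)"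

definition D_symbol :: "nat \<Rightarrow> 'm \<Rightarrow> (nat \<times> 'm \<Rightarrow> 'c::field fls)" where
  "D_symbol i m = (\<lambda>x. if x = (i, m) then 1 else 0)"

definition prolongation_relators ::
    "'c::field set \<Rightarrow> nat \<Rightarrow> ('c fls poly, 'm) module \<Rightarrow> (nat \<times> 'm \<Rightarrow> 'c fls) set" where
  "prolongation_relators K k M =
     (let F = symbols_module K k M in
      {D_symbol i (m1 \<oplus>\<^bsub>M\<^esub> m2) \<ominus>\<^bsub>F\<^esub> (D_symbol i m1 \<oplus>\<^bsub>F\<^esub> D_symbol i m2) | i m1 m2.
         i \<le> k \<and> m1 \<in> carrier M \<and> m2 \<in> carrier M} \<union>
      {D_symbol i (a \<odot>\<^bsub>restrict_scalars M\<^esub> m)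
         \<ominus>\<^bsub>F\<^esub> (\<Oplus>\<^bsub>F\<^esub>j\<in>{..i}. hyperderiv j a \<odot>\<^bsub>F\<^esub> D_symbol (i - j) m) | i a m.
         i \<le> k \<and> a \<in> Kbar_t K \<and> m \<in> carrier M})"

definition prolongation_kernel ::
    "'c::field set \<Rightarrow> nat \<Rightarrow> ('c fls poly, 'm) module \<Rightarrow> (nat \<times> 'm \<Rightarrow> 'c fls) set" where
  "prolongation_kernel K k M =
     generated_submodule (ring_on (Kbar_t K)) (symbols_module K k M) (prolongation_relators K k M)"

definition prolongation_t_module ::
    "'c::field set \<Rightarrow> nat \<Rightarrow> ('c fls poly, 'm) module \<Rightarrow>
     ('c fls, (nat \<times> 'm \<Rightarrow> 'c fls) set) module" where
  "prolongation_t_module K k M =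
     quotient_module (symbols_module K k M) (prolongation_kernel K k M)"

text \<open>
  \<open>\<sigma>(a \<cdot> D\<^sub>i m) = a\<^sup>\<sigma> \<cdot> D\<^sub>i(\<sigma> m)\<close>, extended additively to the free module on the symbols and then
  passed to the quotient.
\<close>

definition symbols_sigma ::
    "nat \<Rightarrow> 'c::field set \<Rightarrow> nat \<Rightarrow> ('c fls poly, 'm) module \<Rightarrow>
     (nat \<times> 'm \<Rightarrow> 'c fls) \<Rightarrow> (nat \<times> 'm \<Rightarrow> 'c fls)" where
  "symbols_sigma q K k M f =
     (\<Oplus>\<^bsub>symbols_module K k M\<^esub>x\<in>{x. f x \<noteq> 0}.
        twist q (f x) \<odot>\<^bsub>symbols_module K k M\<^esub> D_symbol (fst x) (sigma M (snd x)))"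

definition prolongation_sigma ::
    "nat \<Rightarrow> 'c::field set \<Rightarrow> nat \<Rightarrow> ('c fls poly, 'm) module \<Rightarrow>
     (nat \<times> 'm \<Rightarrow> 'c fls) set \<Rightarrow> (nat \<times> 'm \<Rightarrow> 'c fls) set" where
  "prolongation_sigma q K k M Y =
     (\<Union>f\<in>Y. prolongation_kernel K k M +>\<^bsub>symbols_module K k M\<^esub> symbols_sigma q K k M f)"

definition prolongation ::
    "nat \<Rightarrow> 'c::field set \<Rightarrow> nat \<Rightarrow> ('c fls poly, 'm) module \<Rightarrow>
     ('c fls poly, (nat \<times> 'm \<Rightarrow> 'c fls) set) module" where
  "prolongation q K k M =
     (let P = prolongation_t_module K k M in
      \<lparr>carrier = carrier P, monoid.mult = monoid.mult P, one = monoid.one P, ring.zero = ring.zero P, add = add P,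
       module.smult = (\<lambda>f Y. \<Oplus>\<^bsub>P\<^esub>i\<in>{..Polynomial.degree f}.
         Polynomial.coeff f i \<odot>\<^bsub>P\<^esub> (prolongation_sigma q K k M ^^ i) Y)\<rparr>)"

definition prolongation_D ::
    "'c::field set \<Rightarrow> nat \<Rightarrow> ('c fls poly, 'm) module \<Rightarrow> nat \<Rightarrow> 'm \<Rightarrow> (nat \<times> 'm \<Rightarrow> 'c fls) set" where
  "prolongation_D K k M i m =
     prolongation_kernel K k M +>\<^bsub>symbols_module K k M\<^esub> D_symbol i m"

text \<open>
  The entry of \<open>(D\<^sub>0 e\<^sub>0, \<dots>, D\<^sub>0 e\<^sub>r\<^sub>-\<^sub>1, \<dots>, D\<^sub>k e\<^sub>0, \<dots>, D\<^sub>k e\<^sub>r\<^sub>-\<^sub>1)\<close> at position \<open>i * r + h\<close> with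
  \<open>h < r\<close> is \<open>D\<^sub>i e\<^sub>h\<close>; likewise for the rows and columns of \<open>\<rho>\<^sub>[\<^sub>k\<^sub>]\<close>.
\<close>

definition D_tuple ::
    "'c::field set \<Rightarrow> nat \<Rightarrow> ('c fls poly, 'm) module \<Rightarrow> nat \<Rightarrow> (nat \<Rightarrow> 'm) \<Rightarrow>
     nat \<Rightarrow> (nat \<times> 'm \<Rightarrow> 'c fls) set" where
  "D_tuple K k M r e n = prolongation_D K k M (n div r) (e (n mod r))"

definition rho :: "nat \<Rightarrow> 'c::field fls mat \<Rightarrow> 'c fls mat" where
  "rho k \<Theta> =
     (let r = dim_row \<Theta> in
      mat (r * (k + 1)) (r * (k + 1)) (\<lambda>(x, y).
        if x div r \<le> y div r
        then hyperderiv (y div r - x div r) (\<Theta> $$ (x mod r, y mod r))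
        else 0))"

end

theory Submission
  imports Defs "HOL-Library.Function_Algebras"
begin

text \<open>
  \<^bold>\<open>Basis.\<close>  Writing \<open>m = \<Sum>\<^sub>h c\<^sub>h e\<^sub>h\<close>, additivity and the product rule give
  \<open>D\<^sub>i m = \<Sum>\<^sub>h \<Sum>\<^sub>j \<partial>\<^sup>(\<^sup>j\<^sup>)(c\<^sub>h) D\<^sub>i\<^sub>-\<^sub>j e\<^sub>h\<close> (\<open>D_comb_expand\<close>), so the \<open>D\<^sub>l e\<^sub>h\<close> generate the
  prolongation.  For independence, the same formula is used as a definition: assigning to a symbol
  \<open>D\<^sub>i m\<close> the would-be coefficient \<open>\<partial>\<^sup>(\<^sup>i\<^sup>-\<^sup>j\<^sup>)(c\<^sub>h)\<close> of \<open>D\<^sub>j e\<^sub>h\<close> extends linearly to the free module on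
  the symbols and kills all relators, by the Leibniz rule for the hyperderivatives
  (\<open>coord_weight_kernel\<close>).  It therefore descends to the prolongation, where it is the coordinate
  function dual to \<open>D\<^sub>j e\<^sub>h\<close>.

  \<^bold>\<open>Matrix of \<open>\<sigma>\<close>.\<close>  Twisting takes \<open>q\<close>-th roots of coefficients.  In \<open>\<complex>\<^sub>\<infinity>\<close> these exist by completeness
  and density of an algebraically closed subfield, and they are unique and additive because
  \<open>x \<mapsto> x\<^sup>q\<close> is injective and additive.  The prime field is fixed, so twisting commutes with the
  hyperderivatives (\<open>twist_hyperderiv\<close>), and hence \<open>\<sigma>\<close> on the free module maps relators to relators
  and descends (\<open>symbols_sigma_kernel\<close>).  Expanding \<open>\<sigma>(D\<^sub>i e\<^sub>b) = D\<^sub>i(\<sigma> e\<^sub>b)\<close> as above gives the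
  columns of \<open>\<rho>\<^sub>[\<^sub>k\<^sub>](\<Theta>)\<close>.

  \<^bold>\<open>Trivialization.\<close>  By the Leibniz rule \<open>\<rho>\<^sub>[\<^sub>k\<^sub>]\<close> is multiplicative on matrices of power series
  (\<open>rho_mult\<close>), and it commutes with twisting.  The Tate algebra is closed under hyperderivatives,
  because its elements are the power series whose coefficients tend to zero.  Hence \<open>\<rho>\<^sub>[\<^sub>k\<^sub>]\<close> maps
  \<open>GL\<^sub>r\<close> of the Tate algebra to \<open>GL\<^sub>r\<^sub>(\<^sub>k\<^sub>+\<^sub>1\<^sub>)\<close> of it and turns \<open>\<Psi> \<Theta> = \<Psi>\<^sup>\<sigma>\<close> into the equation required of
  \<open>\<rho>\<^sub>[\<^sub>k\<^sub>](\<Psi>)\<close>.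
\<close>

section \<open>Rings on subsets and the q-power map\<close>

lemma ring_of_type_algebra_simps [simp]:
  "carrier ring_of_type_algebra = UNIV"
  "x \<otimes>\<^bsub>ring_of_type_algebra\<^esub> y = x * y"
  "x \<oplus>\<^bsub>ring_of_type_algebra\<^esub> y = x + y"
  "\<one>\<^bsub>ring_of_type_algebra\<^esub> = 1"
  "\<zero>\<^bsub>ring_of_type_algebra\<^esub> = 0"
  by (simp_all add: ring_of_type_algebra_def)

lemma ring_on_simps [simp]:
  "carrier (ring_on S) = S"
  "x \<otimes>\<^bsub>ring_on S\<^esub> y = x * y"
  "x \<oplus>\<^bsub>ring_on S\<^esub> y = x + y"
  "\<one>\<^bsub>ring_on S\<^esub> = 1"
  "\<zero>\<^bsub>ring_on S\<^esub> = 0"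
  by (simp_all add: ring_on_def)

lemma ring_on_nat_pow [simp]: "x [^]\<^bsub>ring_on S\<^esub> (n::nat) = x ^ n"
  by (induction n) (auto simp: mult.commute)

lemma a_inv_ring_of_type_algebra [simp]:
  "\<ominus>\<^bsub>ring_of_type_algebra\<^esub> (x::'a::comm_ring_1) = - x"
proof -
  interpret R: ring "ring_of_type_algebra :: 'a ring" ..
  show ?thesis
    using R.minus_equality[of "- x" x] by simp
qed

lemma cring_ring_on:
  fixes S :: "'a::comm_ring_1 set"
  assumes "0 \<in> S" "1 \<in> S" "\<And>x y. x \<in> S \<Longrightarrow> y \<in> S \<Longrightarrow> x + y \<in> S"
    "\<And>x y. x \<in> S \<Longrightarrow> y \<in> S \<Longrightarrow> x * y \<in> S" "\<And>x. x \<in> S \<Longrightarrow> - x \<in> S"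
  shows "cring (ring_on S)"
proof (rule cringI)
  show "abelian_group (ring_on S)"
    using assms by (intro abelian_groupI) (auto simp: algebra_simps intro: bexI[of _ "- _"])
  show "Group.comm_monoid (ring_on S)"
    using assms by (intro comm_monoidI) (auto simp: algebra_simps)
qed (auto simp: algebra_simps)

lemma subring_ring_of_type_algebra:
  assumes "subring S (ring_of_type_algebra :: 'a::comm_ring_1 ring)"
  shows "0 \<in> S" "1 \<in> S" "\<And>x y. x \<in> S \<Longrightarrow> y \<in> S \<Longrightarrow> x + y \<in> S"
    "\<And>x y. x \<in> S \<Longrightarrow> y \<in> S \<Longrightarrow> x * y \<in> S" "\<And>x. x \<in> S \<Longrightarrow> - x \<in> S"
proof -
  interpret R: ring "ring_of_type_algebra :: 'a ring" ..
  show "0 \<in> S" "1 \<in> S" "\<And>x y. x \<in> S \<Longrightarrow> y \<in> S \<Longrightarrow> x + y \<in> S"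
    "\<And>x y. x \<in> S \<Longrightarrow> y \<in> S \<Longrightarrow> x * y \<in> S" "\<And>x. x \<in> S \<Longrightarrow> - x \<in> S"
    using subringE[OF assms] by simp_all
qed

context function_field_setting
begin

lemma finite_field_power_card:
  assumes "a \<in> Fq"
  shows "a ^ q = a"
proof (cases "a = 0")
  case False
  interpret T: field "ring_of_type_algebra :: 'c ring" ..
  interpret F: field "ring_on Fq"
    using T.subfield_iff(2)[OF Fq(1)] by (simp add: ring_on_def)
  have "Units (ring_on Fq) = Fq - {0}"
    using F.field_Units by simp
  then have "a ^ card (Fq - {0}) = 1"
    using F.units_power_order_eq_one[of a] Fq(2) assms False by simp
  moreover have "card (Fq - {0}) = q - 1" "q > 0"
    using subring_ring_of_type_algebra(1)[OF subfieldE(1)[OF Fq(1)]] Fq(2,3)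
    by (auto simp: card_gt_0_iff)
  ultimately show ?thesis
    using power_minus_mult[of q a] by simp
next
  case True
  have "q > 0" using Fq(2,3) assms by (auto simp: card_gt_0_iff)
  with True show ?thesis by simp
qed

lemma q_gt_1: "q > 1"
proof -
  have "card {0, 1 :: 'c} \<le> card Fq"
    using subring_ring_of_type_algebra(1,2)[OF subfieldE(1)[OF Fq(1)]] Fq(2)
    by (intro card_mono) auto
  then show ?thesis using Fq(3) by simp
qed

text \<open>The two sides are polynomials of degree \<open>q\<close> with leading coefficient \<open>1\<close>, and they agree at
  the \<open>q\<close> points of \<open>\<bbbF>\<^sub>q\<close>, where \<open>a \<mapsto> a\<^sup>q\<close> is the identity.\<close>

lemma frobenius_one: "(x + 1) ^ q = x ^ q + (1 :: 'c)"
proof -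
  define P :: "'c poly" where "P = [:1, 1:] ^ q"
  define Q :: "'c poly" where "Q = Polynomial.monom 1 q + 1"
  have degP: "Polynomial.degree P = q"
    by (simp add: P_def degree_linear_power)
  have degQ: "Polynomial.degree Q = q"
    unfolding Q_def using q_gt_1
    by (subst degree_add_eq_left) (auto simp: degree_monom_eq)
  have "P = Q"
  proof (rule poly_eqI_degree_lead_coeff[where A = Fq and n = q])
    show "poly P a = poly Q a" if "a \<in> Fq" for a
    proof -
      have "a + 1 \<in> Fq"
        using that subring_ring_of_type_algebra(2,3)[OF subfieldE(1)[OF Fq(1)]] by blast
      then show ?thesis
        using finite_field_power_card[of a] finite_field_power_card[of "a + 1"] that
        by (simp add: P_def Q_def poly_monom add.commute)
    qed
    have "Polynomial.coeff P q = 1"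
      using lead_coeff_power[of "[:1, 1 :: 'c:]" q] degP by (simp add: P_def)
    moreover have "Polynomial.coeff Q q = 1"
      using q_gt_1 by (simp add: Q_def)
    ultimately show "Polynomial.coeff P q = Polynomial.coeff Q q" by simp
  qed (use degP degQ Fq in auto)
  then have "poly P x = poly Q x" by simp
  then show ?thesis by (simp add: P_def Q_def poly_monom add.commute)
qed

lemma frobenius_add: "(x + y) ^ q = x ^ q + (y :: 'c) ^ q"
proof (cases "y = 0")
  case True
  then show ?thesis using q_gt_1 by (simp add: power_0_left)
next
  case False
  have "(x + y) ^ q = ((x / y + 1) * y) ^ q"
    using False by (simp add: distrib_right)
  also have "\<dots> = (x / y + 1) ^ q * y ^ q"
    by (rule power_mult_distrib)
  also have "\<dots> = (x / y) ^ q * y ^ q + y ^ q"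
    by (simp only: frobenius_one distrib_right mult_1)
  also have "\<dots> = x ^ q + y ^ q"
    using False by (simp add: power_divide)
  finally show ?thesis .
qed

lemma frobenius_diff: "(x - y) ^ q = x ^ q - (y :: 'c) ^ q"
  using frobenius_add[of "x - y" y] by (simp add: algebra_simps)

text \<open>The prime field is fixed by \<open>x \<mapsto> x\<^sup>q\<close>; the binomial coefficients in the hyperderivatives lie
  there.\<close>

lemma frobenius_of_nat: "of_nat n ^ q = (of_nat n :: 'c)"
  using q_gt_1 by (induction n) (auto simp: frobenius_add add.commute power_0_left)

lemma absv_0 [simp]: "absv 0 = 0"
  using absv_eq_0_iff by blast

lemma absv_1 [simp]: "absv 1 = 1"
  using absv_mult[of 1 1] absv_eq_0_iff[of 1] by simp

lemma absv_uminus [simp]: "absv (- x) = absv x"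
proof -
  have "absv (- 1) * absv (- 1) = 1"
    using absv_mult[of "-1" "-1"] by simp
  then have "absv (- 1) = 1"
    using absv_nonneg[of "- 1"] by (auto simp: square_eq_1_iff)
  then show ?thesis using absv_mult[of "- 1" x] by simp
qed

lemma absv_power: "absv (x ^ n) = absv x ^ n"
  by (induction n) (auto simp: absv_mult)

lemma absv_diff: "absv (x - y) \<le> max (absv x) (absv y)"
  using absv_add[of x "- y"] by simp

lemma absv_of_nat: "absv (of_nat n) \<le> 1"
proof (induction n)
  case (Suc n)
  then show ?case using absv_add[of 1 "of_nat n"] by (simp add: max_def split: if_splits)
qed simp

sublocale absv_metric: Metric_space UNIV "\<lambda>x y. absv (x - y)"
proof
  fix x y z :: 'c
  show "0 \<le> absv (x - y)" by (rule absv_nonneg)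
  show "absv (x - y) = absv (y - x)" using absv_uminus[of "x - y"] by simp
  show "absv (x - y) = 0 \<longleftrightarrow> x = y" using absv_eq_0_iff by simp
  show "absv (x - z) \<le> absv (x - y) + absv (y - z)"
    using absv_add[of "x - y" "y - z"] absv_nonneg[of "x - y"] absv_nonneg[of "y - z"] by simp
qed

lemma av_limitin_iff:
  "limitin (av_topology absv) u l sequentially \<longleftrightarrow> (\<forall>\<epsilon>>0. \<exists>N. \<forall>n\<ge>N. absv (u n - l) < \<epsilon>)"
  by (simp add: av_topology_def absv_metric.limit_metric_sequentially)

lemma av_Cauchy_convergent:
  assumes "\<And>\<epsilon>. \<epsilon> > 0 \<Longrightarrow> \<exists>N. \<forall>n\<ge>N. \<forall>m\<ge>N. absv (u n - u m) < \<epsilon>"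
  obtains l where "limitin (av_topology absv) u l sequentially"
proof -
  have "absv_metric.MCauchy u"
    unfolding absv_metric.MCauchy_def using assms by auto
  then show ?thesis
    using complete that unfolding av_complete_def absv_metric.mcomplete_def av_topology_def
    by blast
qed

text \<open>The polynomial \<open>X\<^sup>q - a\<close> splits over the algebraically closed field \<open>L\<close>.\<close>

lemma closed_subfield_root:
  assumes "algebraic_closure (ring_on L) k0" and a: "a \<in> L"
  shows "\<exists>y\<in>L. y ^ q = a"
proof -
  interpret L: algebraic_closure "ring_on L" k0 by fact
  have neg: "- a \<in> L"
  proof -
    have "\<ominus>\<^bsub>ring_on L\<^esub> a \<in> L" "\<ominus>\<^bsub>ring_on L\<^esub> a + a = 0"
      using L.a_inv_closed[of a] L.l_neg[of a] a by simp_all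
    then show ?thesis by (simp add: eq_neg_iff_add_eq_0[symmetric])
  qed
  have zero: "0 \<in> L" and one: "1 \<in> L"
    using abelian_monoid.zero_closed[OF L.abelian_monoid_axioms]
      monoid.one_closed[OF L.monoid_axioms] by simp_all
  \<comment> \<open>The coefficients of \<open>X\<^sup>q - a\<close>, leading coefficient first.\<close>
  define P where "P = 1 # replicate (q - 1) 0 @ [- a]"
  have P: "P \<in> carrier (poly_ring (ring_on L))"
    using neg zero one by (auto simp: univ_poly_def polynomial_def P_def)
  have "size (L.roots P) = q"
    using L.roots_over_carrier[OF P] q_gt_1 by (simp add: L.splitted_def P_def)
  then obtain y where "y \<in># L.roots P"
    using q_gt_1 by (cases "L.roots P") auto
  then have y: "y \<in> L" "L.eval P y = 0"
    using L.roots_mem_iff_is_root[OF P] by (auto simp: L.is_root_def)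
  have "L.eval (replicate n 0 @ [- a]) y = - a" for n
    by (induction n) auto
  then have "y ^ q - a = 0"
    using y(2) q_gt_1 by (simp add: P_def)
  then show ?thesis using y(1) by auto
qed

text \<open>Approximate \<open>x\<close> by elements of the dense algebraically closed subfield \<open>L\<close> and take their
  \<open>q\<close>-th roots there.  Since \<open>|y - y'|\<^sup>q = |y\<^sup>q - y'\<^sup>q|\<close>, the roots form a Cauchy sequence, and its
  limit is a \<open>q\<close>-th root of \<open>x\<close>.\<close>

lemma frobenius_surj: "\<exists>y. y ^ q = (x :: 'c)"
proof -
  obtain L where L: "algebraic_closure (ring_on L) (av_topology absv closure_of K)"
    and dense: "av_topology absv closure_of L = UNIV"
    using completion_of_closure by blast
  have "\<exists>a\<in>L. absv (x - a) < inverse (real (Suc n))" for n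
  proof -
    have "x \<in> av_topology absv closure_of L" using dense by simp
    then show ?thesis
      unfolding av_topology_def absv_metric.metric_closure_of by (auto simp: absv_metric.in_mball)
  qed
  then have "\<exists>y. absv (x - y ^ q) < inverse (real (Suc n))" for n
    using closed_subfield_root[OF L] by blast
  then obtain y where y: "\<And>n. absv (x - y n ^ q) < inverse (real (Suc n))"
    by metis
  have small: "\<exists>N. \<forall>n\<ge>N. absv (x - y n ^ q) < \<epsilon>" if "\<epsilon> > 0" for \<epsilon>
  proof -
    obtain N where N: "inverse (real (Suc N)) < \<epsilon>"
      using reals_Archimedean[OF \<open>\<epsilon> > 0\<close>] by blast
    have "absv (x - y n ^ q) < \<epsilon>" if "n \<ge> N" for n
    proof -
      have "inverse (real (Suc n)) \<le> inverse (real (Suc N))"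
        using that by (simp add: field_simps)
      then show ?thesis using y[of n] N by linarith
    qed
    then show ?thesis by blast
  qed
  obtain l where l: "limitin (av_topology absv) y l sequentially"
  proof (rule av_Cauchy_convergent)
    fix \<epsilon> :: real assume "\<epsilon> > 0"
    then obtain N where N: "\<And>n. n \<ge> N \<Longrightarrow> absv (x - y n ^ q) < \<epsilon> ^ q"
      using small[of "\<epsilon> ^ q"] by auto
    have "absv (y n - y m) < \<epsilon>" if "n \<ge> N" "m \<ge> N" for n m
    proof -
      have "absv (y n - y m) ^ q = absv ((x - y m ^ q) - (x - y n ^ q))"
        by (simp add: frobenius_diff flip: absv_power)
      also have "\<dots> < \<epsilon> ^ q"
        using absv_diff[of "x - y m ^ q" "x - y n ^ q"] N[OF that(1)] N[OF that(2)] by linarith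
      finally show ?thesis
        using \<open>\<epsilon> > 0\<close> power_less_imp_less_base by fastforce
    qed
    then show "\<exists>N. \<forall>n\<ge>N. \<forall>m\<ge>N. absv (y n - y m) < \<epsilon>" by blast
  qed
  have "absv (x - l ^ q) = 0"
  proof (rule ccontr)
    assume "absv (x - l ^ q) \<noteq> 0"
    then have pos: "absv (x - l ^ q) > 0"
      using absv_nonneg[of "x - l ^ q"] by linarith
    obtain N where N: "\<And>n. n \<ge> N \<Longrightarrow> absv (x - y n ^ q) < absv (x - l ^ q)"
      using small[OF pos] by blast
    \<comment> \<open>On elements of absolute value below 1, taking \<open>q\<close>-th powers only decreases the absolute value.\<close>
    have "min 1 (absv (x - l ^ q)) > 0" using pos by simp
    then obtain N' where N': "\<And>n. n \<ge> N' \<Longrightarrow> absv (y n - l) < min 1 (absv (x - l ^ q))"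
      using l unfolding av_limitin_iff by blast
    define n where "n = max N N'"
    have n: "absv (y n - l) < 1" "absv (y n - l) < absv (x - l ^ q)"
      using N'[of n] by (simp_all add: n_def)
    have "absv (y n ^ q - l ^ q) = absv (y n - l) ^ q"
      by (simp add: frobenius_diff flip: absv_power)
    also have "\<dots> \<le> absv (y n - l) ^ 1"
      using n absv_nonneg q_gt_1 by (intro power_decreasing) auto
    also have "\<dots> < absv (x - l ^ q)"
      using n by simp
    finally have "absv (y n ^ q - l ^ q) < absv (x - l ^ q)" .
    moreover have "absv (x - l ^ q) \<le> max (absv (x - y n ^ q)) (absv (y n ^ q - l ^ q))"
      using absv_add[of "x - y n ^ q" "y n ^ q - l ^ q"] by simp
    moreover have "absv (x - y n ^ q) < absv (x - l ^ q)"
      using N[of n] by (simp add: n_def)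
    ultimately show False by linarith
  qed
  then show ?thesis using absv_eq_0_iff[of "x - l ^ q"] by auto
qed

lemma qth_root_unique: "y ^ q = x \<Longrightarrow> z ^ q = x \<Longrightarrow> y = (z :: 'c)"
  using frobenius_diff[of y z] by simp

lemma qth_root_eqI: "y ^ q = x \<Longrightarrow> qth_root q x = (y :: 'c)"
  unfolding qth_root_def using qth_root_unique by blast

lemma qth_root_power [simp]: "qth_root q x ^ q = (x :: 'c)"
  using frobenius_surj[of x] qth_root_eqI by metis

lemma qth_root_0 [simp]: "qth_root q 0 = (0 :: 'c)"
  using q_gt_1 by (intro qth_root_eqI) auto

lemma qth_root_1 [simp]: "qth_root q 1 = (1 :: 'c)"
  by (intro qth_root_eqI) auto

lemma qth_root_add: "qth_root q (x + y) = qth_root q x + qth_root q (y :: 'c)"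
  by (intro qth_root_eqI) (simp add: frobenius_add)

lemma qth_root_mult: "qth_root q (x * y) = qth_root q x * qth_root q (y :: 'c)"
  by (intro qth_root_eqI) (simp add: power_mult_distrib)

lemma qth_root_of_nat_mult: "qth_root q (of_nat n * x) = of_nat n * qth_root q (x :: 'c)"
  by (intro qth_root_eqI) (simp add: power_mult_distrib frobenius_of_nat)

lemma qth_root_sum: "qth_root q (sum f A) = (\<Sum>x\<in>A. qth_root q (f x :: 'c))"
  by (induction A rule: infinite_finite_induct) (auto simp: qth_root_add)

end

section \<open>Hyperderivatives and twisting of power series\<close>

text \<open>The restriction of \<^const>\<open>hyperderiv\<close> to power series, where all binomial coefficients are natural
  numbers.  Every Laurent series to which the product rule is applied lies in \<open>Kbar[t]\<close> or in the Tate
  algebra, hence is a power series.\<close>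

definition fps_hyperderiv :: "nat \<Rightarrow> 'a::comm_ring_1 fps \<Rightarrow> 'a fps" where
  "fps_hyperderiv n f = Abs_fps (\<lambda>j. of_nat ((j + n) choose n) * fps_nth f (j + n))"

lemma fps_nth_hyperderiv [simp]:
  "fps_nth (fps_hyperderiv n f) j = of_nat ((j + n) choose n) * fps_nth f (j + n)"
  by (simp add: fps_hyperderiv_def)

text \<open>The Leibniz rule is Vandermonde's identity
  \<open>binom(a + b, n) = \<Sum>\<^sub>i binom(a, i) binom(b, n - i)\<close> applied to each pair of monomials
  \<open>t\<^sup>a\<close>, \<open>t\<^sup>b\<close>; the terms with \<open>a < i\<close> or \<open>b < n - i\<close> vanish, which matches the index shifts.\<close>

lemma fps_hyperderiv_mult:
  "fps_hyperderiv n (f * g) = (\<Sum>i\<le>n. fps_hyperderiv i f * fps_hyperderiv (n - i) g)"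
proof (rule fps_ext)
  fix j
  define h where "h i a = of_nat ((a choose i) * ((j + n - a) choose (n - i))) *
     (fps_nth f a * fps_nth g (j + n - a))" for i a
  have "fps_nth (fps_hyperderiv n (f * g)) j =
      (\<Sum>a\<le>j + n. of_nat ((a + (j + n - a)) choose n) * (fps_nth f a * fps_nth g (j + n - a)))"
    by (simp add: fps_mult_nth sum_distrib_left atLeast0AtMost)
  also have "\<dots> = (\<Sum>a\<le>j + n. \<Sum>i\<le>n. h i a)"
    by (simp only: vandermonde[symmetric] of_nat_sum sum_distrib_right h_def)
  also have "\<dots> = (\<Sum>i\<le>n. \<Sum>a\<le>j + n. h i a)"
    by (rule sum.swap)
  also have "\<dots> = (\<Sum>i\<le>n. fps_nth (fps_hyperderiv i f * fps_hyperderiv (n - i) g) j)"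
  proof (rule sum.cong[OF refl])
    fix i assume "i \<in> {..n}"
    then have i: "i \<le> n" by simp
    have "(\<Sum>a\<le>j + n. h i a) = (\<Sum>a\<in>{i..j + i}. h i a)"
      using i by (intro sum.mono_neutral_right) (auto simp: h_def not_le binomial_eq_0)
    also have "\<dots> = (\<Sum>b\<le>j. h i (b + i))"
      by (rule sum.reindex_bij_witness[of _ "\<lambda>b. b + i" "\<lambda>a. a - i"]) auto
    also have "\<dots> = (\<Sum>b\<le>j. fps_nth (fps_hyperderiv i f) b * fps_nth (fps_hyperderiv (n - i) g) (j - b))"
    proof (rule sum.cong[OF refl])
      fix b assume "b \<in> {..j}"
      then have "j + n - (b + i) = j - b + (n - i)" using i by simp
      then show "h i (b + i) = fps_nth (fps_hyperderiv i f) b * fps_nth (fps_hyperderiv (n - i) g) (j - b)"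
        by (simp add: h_def algebra_simps)
    qed
    also have "\<dots> = fps_nth (fps_hyperderiv i f * fps_hyperderiv (n - i) g) j"
      by (simp add: fps_mult_nth atLeast0AtMost)
    finally show "(\<Sum>a\<le>j + n. h i a) = fps_nth (fps_hyperderiv i f * fps_hyperderiv (n - i) g) j" .
  qed
  finally show "fps_nth (fps_hyperderiv n (f * g)) j =
      fps_nth (\<Sum>i\<le>n. fps_hyperderiv i f * fps_hyperderiv (n - i) g) j"
    by (simp add: fps_sum_nth)
qed

lemma fls_nth_hyperderiv:
  "fls_nth (hyperderiv n f) j = of_int (int_binomial (j + int n) n) * fls_nth f (j + int n)"
proof -
  obtain N where "\<forall>m<N. fls_nth f m = 0" by (rule fls_nth_vanishes_belowE)
  then have "\<forall>j<N - int n. of_int (int_binomial (j + int n) n) * fls_nth f (j + int n) = 0"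
    by simp
  then show ?thesis
    unfolding hyperderiv_def by (rule nth_Abs_fls_lower_bound)
qed

lemma int_binomial_of_nat: "int_binomial (int m) n = int (m choose n)"
proof -
  have "real_of_int (\<Prod>j=0..<n. int m - int j) = fact n * (real m gchoose n)"
    by (simp add: gbinomial_mult_fact)
  also have "\<dots> = real_of_int (int (m choose n) * fact n)"
    by (simp add: binomial_gbinomial mult.commute)
  finally have "(\<Prod>j=0..<n. int m - int j) = int (m choose n) * fact n"
    by (simp only: of_int_eq_iff)
  then show ?thesis by (simp add: int_binomial_def)
qed

text \<open>A coefficient of \<open>t\<^sup>j\<close> with \<open>j < 0\<close> could only come from an exponent \<open>0 \<le> j + n < n\<close>, where the
  falling factorial in the binomial coefficient contains the factor \<open>0\<close>.\<close>

lemma hyperderiv_fps_to_fls: "hyperderiv n (fps_to_fls f) = fps_to_fls (fps_hyperderiv n f)"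
proof (rule fls_eqI)
  fix j
  show "fls_nth (hyperderiv n (fps_to_fls f)) j = fls_nth (fps_to_fls (fps_hyperderiv n f)) j"
  proof (cases "j < 0")
    case True
    show ?thesis
    proof (cases "j + int n < 0")
      case False
      with True have "(\<Prod>i=0..<n. j + int n - int i) = 0"
        by (intro prod_zero) (auto intro!: bexI[of _ "nat (j + int n)"])
      then have "int_binomial (j + int n) n = 0"
        by (simp only: int_binomial_def div_0)
      then show ?thesis using True by (simp add: fls_nth_hyperderiv)
    qed (use True in \<open>simp add: fls_nth_hyperderiv\<close>)
  next
    case False
    then have "int_binomial (j + int n) n = int ((nat j + n) choose n)"
      using int_binomial_of_nat[of "nat j + n" n] by simp
    then show ?thesis using False by (simp add: fls_nth_hyperderiv nat_add_distrib)
  qed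
qed

lemma hyperderiv_0 [simp]: "hyperderiv n 0 = 0"
  by (rule fls_eqI) (simp add: fls_nth_hyperderiv)

lemma hyperderiv_add: "hyperderiv n (f + g) = hyperderiv n f + hyperderiv n g"
  by (rule fls_eqI) (simp add: fls_nth_hyperderiv algebra_simps)

lemma hyperderiv_sum: "hyperderiv n (sum f A) = (\<Sum>x\<in>A. hyperderiv n (f x))"
  by (induction A rule: infinite_finite_induct) (auto simp: hyperderiv_add)

lemma hyperderiv_zeroth [simp]: "hyperderiv 0 f = f"
  by (rule fls_eqI) (simp add: fls_nth_hyperderiv int_binomial_def)

lemma hyperderiv_1: "hyperderiv n 1 = (if n = 0 then 1 else 0 :: 'c::field fls)"
proof -
  have "fps_hyperderiv n 1 = (if n = 0 then 1 else 0 :: 'c fps)"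
    by (rule fps_ext) auto
  then show ?thesis
    using hyperderiv_fps_to_fls[of n "1 :: 'c fps"] by auto
qed

lemma fps_to_fls_sum: "fps_to_fls (sum f A) = (\<Sum>x\<in>A. fps_to_fls (f x))"
  by (induction A rule: infinite_finite_induct) auto

lemma hyperderiv_mult:
  assumes "f \<in> range fps_to_fls" "g \<in> range fps_to_fls"
  shows "hyperderiv n (f * g) = (\<Sum>i\<le>n. hyperderiv i f * hyperderiv (n - i) g)"
  using assms
  by (auto simp: hyperderiv_fps_to_fls fps_hyperderiv_mult fps_to_fls_sum fls_times_fps_to_fls
      simp flip: fls_times_fps_to_fls)

context function_field_setting
begin

lemma fls_nth_twist: "fls_nth (twist q f) n = qth_root q (fls_nth f n :: 'c)"
proof -
  obtain N where "\<forall>m<N. fls_nth f m = 0" by (rule fls_nth_vanishes_belowE)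
  then have "\<forall>m<N. qth_root q (fls_nth f m) = 0" by simp
  then show ?thesis unfolding twist_def by (rule nth_Abs_fls_lower_bound)
qed

lemma twist_0 [simp]: "twist q 0 = (0 :: 'c fls)"
  by (rule fls_eqI) (simp add: fls_nth_twist)

lemma twist_add: "twist q (f + g) = twist q f + twist q (g :: 'c fls)"
  by (rule fls_eqI) (simp add: fls_nth_twist qth_root_add)

lemma twist_fps_to_fls:
  "twist q (fps_to_fls f) = fps_to_fls (Abs_fps (\<lambda>n. qth_root q (fps_nth f n :: 'c)))"
  by (rule fls_eqI) (simp add: fls_nth_twist)

lemma twist_1 [simp]: "twist q 1 = (1 :: 'c fls)"
  by (rule fls_eqI) (simp add: fls_nth_twist)

lemma twist_mult:
  assumes "f \<in> range fps_to_fls" "g \<in> range fps_to_fls"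
  shows "twist q (f * g) = twist q f * twist q (g :: 'c fls)"
proof -
  obtain a b where ab: "f = fps_to_fls a" "g = fps_to_fls b" using assms by auto
  have "Abs_fps (\<lambda>n. qth_root q (fps_nth (a * b) n)) =
      Abs_fps (\<lambda>n. qth_root q (fps_nth a n)) * Abs_fps (\<lambda>n. qth_root q (fps_nth b n))"
    by (rule fps_ext) (simp add: fps_mult_nth qth_root_sum qth_root_mult)
  then show ?thesis
    unfolding ab fls_times_fps_to_fls[symmetric] twist_fps_to_fls by simp
qed

text \<open>The binomial coefficients lie in the prime field, whose elements are their own \<open>q\<close>-th roots.\<close>

lemma twist_hyperderiv:
  assumes "f \<in> range fps_to_fls"
  shows "twist q (hyperderiv n f) = hyperderiv n (twist q (f :: 'c fls))"
proof -
  obtain a where a: "f = fps_to_fls a" using assms by auto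
  have "Abs_fps (\<lambda>j. qth_root q (fps_nth (fps_hyperderiv n a) j)) =
      fps_hyperderiv n (Abs_fps (\<lambda>j. qth_root q (fps_nth a j)))"
    by (rule fps_ext) (simp add: qth_root_of_nat_mult)
  then show ?thesis
    unfolding a twist_fps_to_fls hyperderiv_fps_to_fls by simp
qed

lemma subring_Kbar: "subring (Kbar K) (ring_of_type_algebra :: 'c ring)"
proof -
  interpret T: field "ring_of_type_algebra :: 'c ring" ..
  show ?thesis
    using subfieldE(1)[OF T.subfield_of_algebraics[OF K(1)]] by (simp add: Kbar_def)
qed

lemmas Kbar_closed = subring_ring_of_type_algebra[OF subring_Kbar]

lemma Kbar_of_nat: "of_nat n \<in> Kbar K"
  by (induction n) (auto simp: Kbar_closed)

lemma Kbar_sum: "(\<And>x. x \<in> A \<Longrightarrow> f x \<in> Kbar K) \<Longrightarrow> sum f A \<in> Kbar K"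
  by (induction A rule: infinite_finite_induct) (auto simp: Kbar_closed)

end

text \<open>Seen as power series, the elements of \<open>Kbar[t]\<close> are those with finitely many nonzero coefficients,
  all in \<open>Kbar\<close>; this form passes through \<open>hyperderiv_fps_to_fls\<close>.\<close>

lemma Kbar_t_iff:
  "f \<in> Kbar_t K \<longleftrightarrow> (\<exists>g N. f = fps_to_fls g \<and> (\<forall>n. fps_nth g n \<in> Kbar K) \<and> (\<forall>n\<ge>N. fps_nth g n = 0))"
proof
  assume "f \<in> Kbar_t K"
  then obtain p where "f = fps_to_fls (fps_of_poly p)" "\<forall>i. Polynomial.coeff p i \<in> Kbar K"
    unfolding Kbar_t_def by blast
  moreover have "\<forall>n\<ge>Suc (Polynomial.degree p). Polynomial.coeff p n = 0"
    by (auto intro: coeff_eq_0)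
  ultimately show "\<exists>g N. f = fps_to_fls g \<and> (\<forall>n. fps_nth g n \<in> Kbar K) \<and> (\<forall>n\<ge>N. fps_nth g n = 0)"
    by (intro exI[of _ "fps_of_poly p"] exI[of _ "Suc (Polynomial.degree p)"]) simp
next
  assume "\<exists>g N. f = fps_to_fls g \<and> (\<forall>n. fps_nth g n \<in> Kbar K) \<and> (\<forall>n\<ge>N. fps_nth g n = 0)"
  then obtain g N where g: "f = fps_to_fls g" "\<And>n. fps_nth g n \<in> Kbar K"
    "\<And>n. n \<ge> N \<Longrightarrow> fps_nth g n = 0" by blast
  define p where "p = Poly (map (fps_nth g) [0..<N])"
  have "Polynomial.coeff p n = fps_nth g n" for n
    using g(3)[of n] by (simp add: p_def nth_default_def)
  then have "fps_of_poly p = g" "\<forall>i. Polynomial.coeff p i \<in> Kbar K"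
    using g(2) by (auto intro: fps_ext)
  then show "f \<in> Kbar_t K" using g(1) unfolding Kbar_t_def by blast
qed

lemma Kbar_t_power_series: "Kbar_t K \<subseteq> range fps_to_fls"
  by (auto simp: Kbar_t_def)

context function_field_setting
begin

lemma cring_Kbar_t: "cring (ring_on (Kbar_t K))"
proof (rule cring_ring_on)
  fix x y assume "x \<in> Kbar_t K" "y \<in> Kbar_t K"
  then obtain p p' where p: "x = fps_to_fls (fps_of_poly p)" "\<forall>i. Polynomial.coeff p i \<in> Kbar K"
    and p': "y = fps_to_fls (fps_of_poly p')" "\<forall>i. Polynomial.coeff p' i \<in> Kbar K"
    unfolding Kbar_t_def by blast
  have "x + y = fps_to_fls (fps_of_poly (p + p'))" "x * y = fps_to_fls (fps_of_poly (p * p'))"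
    "- x = fps_to_fls (fps_of_poly (- p))"
    by (simp_all add: p p' fps_of_poly_add fps_of_poly_mult fls_times_fps_to_fls fps_of_poly_uminus)
  moreover have "\<forall>i. Polynomial.coeff (p + p') i \<in> Kbar K" "\<forall>i. Polynomial.coeff (p * p') i \<in> Kbar K"
    "\<forall>i. Polynomial.coeff (- p) i \<in> Kbar K"
    using p(2) p'(2) by (auto simp: coeff_mult intro!: Kbar_closed Kbar_sum)
  ultimately show "x + y \<in> Kbar_t K" "x * y \<in> Kbar_t K" "- x \<in> Kbar_t K"
    unfolding Kbar_t_def by blast+
next
  show "0 \<in> Kbar_t K" "1 \<in> Kbar_t K"
    unfolding Kbar_t_def using Kbar_closed(1,2)
    by (auto intro!: exI[of _ "0 :: 'c poly"] exI[of _ "1 :: 'c poly"] simp: coeff_pCons one_pCons split: nat.split)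
qed

lemma Kbar_t_hyperderiv:
  assumes "f \<in> Kbar_t K"
  shows "hyperderiv n f \<in> Kbar_t K"
proof -
  obtain g N where g: "f = fps_to_fls g" "\<And>n. fps_nth g n \<in> Kbar K"
    "\<And>n. n \<ge> N \<Longrightarrow> fps_nth g n = 0" using assms unfolding Kbar_t_iff by blast
  show ?thesis
    unfolding Kbar_t_iff g(1) hyperderiv_fps_to_fls
    by (rule exI[of _ "fps_hyperderiv n g"], rule exI[of _ N])
      (auto simp: g Kbar_closed Kbar_of_nat)
qed

end

section \<open>The Tate algebra\<close>

context function_field_setting
begin

lemma absv_sum_less:
  assumes "\<epsilon> > 0" "\<And>x. x \<in> A \<Longrightarrow> absv (f x) < \<epsilon>"
  shows "absv (sum f A) < \<epsilon>"
  using assms(2)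
proof (induction A rule: infinite_finite_induct)
  case (insert x A)
  have "absv (f x + sum f A) \<le> max (absv (f x)) (absv (sum f A))"
    by (rule absv_add)
  also have "\<dots> < \<epsilon>" using insert by simp
  finally show ?case using insert by simp
qed (use assms(1) in simp_all)

text \<open>In a complete ultrametric field a series converges as soon as its terms tend to zero, since a
  finite sum is no larger than its largest term.\<close>

lemma av_series_convergent:
  assumes "\<And>\<epsilon>. \<epsilon> > 0 \<Longrightarrow> \<exists>N. \<forall>n\<ge>N. absv (a n) < \<epsilon>"
  shows "\<exists>s. limitin (av_topology absv) (\<lambda>N. \<Sum>n<N. a n) s sequentially"
proof -
  have "\<exists>N. \<forall>n\<ge>N. \<forall>m\<ge>N. absv ((\<Sum>i<n. a i) - (\<Sum>i<m. a i)) < \<epsilon>" if \<epsilon>: "\<epsilon> > 0" for \<epsilon>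
  proof -
    obtain N where N: "\<And>n. n \<ge> N \<Longrightarrow> absv (a n) < \<epsilon>" using assms[OF \<epsilon>] by blast
    have le: "absv ((\<Sum>i<n. a i) - (\<Sum>i<m. a i)) < \<epsilon>" if "m \<ge> N" "m \<le> n" for n m
    proof -
      have "(\<Sum>i<n. a i) - (\<Sum>i<m. a i) = (\<Sum>i\<in>{m..<n}. a i)"
        using sum_diff_nat_ivl[of 0 m n a] that by (simp add: atLeast0LessThan)
      then show ?thesis using N that \<epsilon> by (auto intro!: absv_sum_less)
    qed
    have "absv ((\<Sum>i<n. a i) - (\<Sum>i<m. a i)) < \<epsilon>" if "m \<ge> N" "n \<ge> N" for n m
    proof (cases "m \<le> n")
      case True
      then show ?thesis using le that by blast
    next
      case False
      then show ?thesis
        using le[of n m] that absv_uminus[of "(\<Sum>i<n. a i) - (\<Sum>i<m. a i)"] by simp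
    qed
    then show ?thesis by blast
  qed
  then show ?thesis by (rule av_Cauchy_convergent) auto
qed

text \<open>Convergence on the closed unit disc is decided by the coefficients alone: at \<open>z = 1\<close> it forces
  them to tend to zero, and then \<open>av_series_convergent\<close> applies at every \<open>|z| \<le> 1\<close>.\<close>

lemma tate_algebra_iff:
  "f \<in> tate_algebra absv \<longleftrightarrow>
     (\<exists>g. f = fps_to_fls g \<and> (\<forall>\<epsilon>>0. \<exists>N. \<forall>n\<ge>N. absv (fps_nth g n) < \<epsilon>))"
proof
  assume f: "f \<in> tate_algebra absv"
  define g where "g = fls_regpart f"
  have fg: "f = fps_to_fls g"
    using f by (intro fls_eqI) (simp add: g_def tate_algebra_def)
  have "absv 1 \<le> 1" by simp
  then obtain s where s: "limitin (av_topology absv) (\<lambda>N. \<Sum>n<N. fps_nth g n) s sequentially"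
    using f unfolding tate_algebra_def fg by (auto dest!: spec[of _ 1])
  have "\<exists>N. \<forall>n\<ge>N. absv (fps_nth g n) < \<epsilon>" if \<epsilon>: "\<epsilon> > 0" for \<epsilon>
  proof -
    obtain N where N: "\<And>n. n \<ge> N \<Longrightarrow> absv ((\<Sum>i<n. fps_nth g i) - s) < \<epsilon>"
      using s \<epsilon> unfolding av_limitin_iff by blast
    have "absv (fps_nth g n) < \<epsilon>" if "n \<ge> N" for n
    proof -
      have "fps_nth g n = ((\<Sum>i<Suc n. fps_nth g i) - s) - ((\<Sum>i<n. fps_nth g i) - s)"
        by simp
      then show ?thesis
        using absv_diff[of "(\<Sum>i<Suc n. fps_nth g i) - s" "(\<Sum>i<n. fps_nth g i) - s"]
          N[of "Suc n"] N[of n] that by simp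
    qed
    then show ?thesis by blast
  qed
  then show "\<exists>g. f = fps_to_fls g \<and> (\<forall>\<epsilon>>0. \<exists>N. \<forall>n\<ge>N. absv (fps_nth g n) < \<epsilon>)"
    using fg by blast
next
  assume "\<exists>g. f = fps_to_fls g \<and> (\<forall>\<epsilon>>0. \<exists>N. \<forall>n\<ge>N. absv (fps_nth g n) < \<epsilon>)"
  then obtain g where fg: "f = fps_to_fls g"
    and lim: "\<And>\<epsilon>. \<epsilon> > 0 \<Longrightarrow> \<exists>N. \<forall>n\<ge>N. absv (fps_nth g n) < \<epsilon>" by blast
  have "\<exists>s. limitin (av_topology absv) (\<lambda>N. \<Sum>n<N. fps_nth g n * z ^ n) s sequentially"
    if z: "absv z \<le> 1" for z
  proof (rule av_series_convergent)
    fix \<epsilon> :: real assume "\<epsilon> > 0"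
    then obtain N where N: "\<And>n. n \<ge> N \<Longrightarrow> absv (fps_nth g n) < \<epsilon>" using lim by blast
    have "absv (fps_nth g n * z ^ n) \<le> absv (fps_nth g n)" for n
      using z absv_nonneg by (simp add: absv_mult absv_power mult_left_le power_le_one)
    then show "\<exists>N. \<forall>n\<ge>N. absv (fps_nth g n * z ^ n) < \<epsilon>"
      using N by (meson le_less_trans)
  qed
  then show "f \<in> tate_algebra absv" by (simp add: tate_algebra_def fg)
qed

lemma tate_algebra_power_series: "tate_algebra absv \<subseteq> range fps_to_fls"
  by (auto simp: tate_algebra_iff)

text \<open>Integers have absolute value at most \<open>1\<close>, so a hyperderivative still has coefficients tending to
  zero.\<close>

lemma tate_algebra_hyperderiv:
  assumes "f \<in> tate_algebra absv"
  shows "hyperderiv n f \<in> tate_algebra absv"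
proof -
  obtain g where g: "f = fps_to_fls g"
    and lim: "\<And>\<epsilon>. \<epsilon> > 0 \<Longrightarrow> \<exists>N. \<forall>n\<ge>N. absv (fps_nth g n) < \<epsilon>"
    using assms unfolding tate_algebra_iff by blast
  have "\<exists>N. \<forall>j\<ge>N. absv (fps_nth (fps_hyperderiv n g) j) < \<epsilon>" if \<epsilon>: "\<epsilon> > 0" for \<epsilon>
  proof -
    obtain N where N: "\<And>n. n \<ge> N \<Longrightarrow> absv (fps_nth g n) < \<epsilon>" using lim[OF \<epsilon>] by blast
    have "absv (fps_nth (fps_hyperderiv n g) j) \<le> absv (fps_nth g (j + n))" for j
      using absv_of_nat absv_nonneg by (simp add: absv_mult mult_left_le_one_le)
    then show ?thesis using N by (meson le_less_trans trans_le_add1)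
  qed
  then show ?thesis unfolding tate_algebra_iff g hyperderiv_fps_to_fls by blast
qed

lemma zero_in_tate_algebra: "0 \<in> tate_algebra absv"
  unfolding tate_algebra_iff by (rule exI[of _ 0]) auto

end

section \<open>The block matrices\<close>

text \<open>A position \<open>n < r (k + 1)\<close> in a row of \<open>k + 1\<close> blocks of length \<open>r\<close> is a block number together with
  a place in the block.\<close>

lemma sum_blocks:
  fixes g :: "nat \<Rightarrow> nat \<Rightarrow> 'a::comm_monoid_add"
  shows "(\<Sum>n<r * (k + 1). g (n div r) (n mod r)) = (\<Sum>i\<le>k. \<Sum>h<r. g i h)"
proof -
  have "(\<Sum>n<r * (k + 1). g (n div r) (n mod r)) =
      (\<Sum>i<k + 1. \<Sum>n\<in>{i * r..<i * r + r}. g (n div r) (n mod r))"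
    by (simp only: sum.nat_group mult.commute)
  also have "\<dots> = (\<Sum>i<k + 1. \<Sum>h<r. g i h)"
  proof (rule sum.cong[OF refl])
    fix i
    show "(\<Sum>n\<in>{i * r..<i * r + r}. g (n div r) (n mod r)) = (\<Sum>h<r. g i h)"
      by (rule sum.reindex_bij_witness[of _ "\<lambda>h. i * r + h" "\<lambda>n. n - i * r"])
        (auto simp: div_nat_eqI mod_nat_eqI le_Suc_ex nat_le_iff_add)
  qed
  finally show ?thesis by (simp add: lessThan_Suc_atMost)
qed

lemma block_index_less:
  fixes x r k :: nat
  assumes "x < r * (k + 1)"
  shows "x mod r < r" "x div r \<le> k"
proof -
  have "r > 0" using assms by (cases r) auto
  then show "x mod r < r" by simp
  have "x div r < k + 1"
    using assms by (intro less_mult_imp_div_less) (simp add: mult.commute)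
  then show "x div r \<le> k" by simp
qed

lemma rho_carrier [simp]: "A \<in> carrier_mat r r \<Longrightarrow> rho k A \<in> carrier_mat (r * (k + 1)) (r * (k + 1))"
  by (auto simp: rho_def Let_def)

lemma rho_index:
  assumes "A \<in> carrier_mat r r" "x < r * (k + 1)" "y < r * (k + 1)"
  shows "rho k A $$ (x, y) = (if x div r \<le> y div r
    then hyperderiv (y div r - x div r) (A $$ (x mod r, y mod r)) else 0)"
  using assms by (auto simp: rho_def Let_def)

lemma elements_mat_subsetI:
  assumes "A \<in> carrier_mat m n" "\<And>i j. i < m \<Longrightarrow> j < n \<Longrightarrow> A $$ (i, j) \<in> S"
  shows "elements_mat A \<subseteq> S"
  using assms by (auto dest!: elements_matD)

lemma elements_mat_subsetD:
  assumes "elements_mat A \<subseteq> S" "A \<in> carrier_mat m n" "i < m" "j < n"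
  shows "A $$ (i, j) \<in> S"
  by (rule subsetD[OF assms(1) elements_matI[OF assms(2-4) refl]])

lemma rho_elements:
  assumes "A \<in> carrier_mat r r" "elements_mat A \<subseteq> S" "0 \<in> S"
    and "\<And>n f. f \<in> S \<Longrightarrow> hyperderiv n f \<in> S"
  shows "elements_mat (rho k A) \<subseteq> S"
proof (rule elements_mat_subsetI[OF rho_carrier[OF assms(1)]])
  fix x y assume xy: "x < r * (k + 1)" "y < r * (k + 1)"
  have "A $$ (x mod r, y mod r) \<in> S"
    by (intro elements_mat_subsetD[OF assms(2,1)] block_index_less(1)[OF xy(1)] block_index_less(1)[OF xy(2)])
  then show "rho k A $$ (x, y) \<in> S"
    using assms(3,4) by (simp add: rho_index[OF assms(1) xy])
qed

text \<open>Block \<open>(i, j)\<close> of the product on the right is a sum over intermediate blocks \<open>l\<close> with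
  \<open>i \<le> l \<le> j\<close>, and this is the Leibniz expansion of \<open>\<partial>\<^sup>(\<^sup>j\<^sup>-\<^sup>i\<^sup>)\<close> of the entries of \<open>A * B\<close>.\<close>

lemma rho_mult:
  assumes A: "A \<in> carrier_mat r r" "elements_mat A \<subseteq> range fps_to_fls"
    and B: "B \<in> carrier_mat r r" "elements_mat B \<subseteq> range fps_to_fls"
  shows "rho k (A * B) = rho k A * rho k B"
proof (rule eq_matI)
  have AB: "A * B \<in> carrier_mat r r" using A B by simp
  fix x y assume "x < dim_row (rho k A * rho k B)" "y < dim_col (rho k A * rho k B)"
  then have x: "x < r * (k + 1)" and y: "y < r * (k + 1)"
    using rho_carrier[OF A(1), of k] rho_carrier[OF B(1), of k] by auto
  define i j a b where "i = x div r" and "j = y div r" and "a = x mod r" and "b = y mod r"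
  have ab: "a < r" "b < r" and ij: "i \<le> k" "j \<le> k"
    using block_index_less[OF x] block_index_less[OF y] by (simp_all add: i_def j_def a_def b_def)
  define g where "g l h = (if i \<le> l then hyperderiv (l - i) (A $$ (a, h)) else 0) *
    (if l \<le> j then hyperderiv (j - l) (B $$ (h, b)) else 0)" for l h
  have "(rho k A * rho k B) $$ (x, y) = (\<Sum>n<r * (k + 1). rho k A $$ (x, n) * rho k B $$ (n, y))"
    using x y rho_carrier[OF A(1), of k] rho_carrier[OF B(1), of k]
    by (simp add: scalar_prod_def atLeast0LessThan)
  also have "\<dots> = (\<Sum>n<r * (k + 1). g (n div r) (n mod r))"
    using x y by (intro sum.cong refl)
      (simp add: rho_index[OF A(1)] rho_index[OF B(1)] g_def i_def j_def a_def b_def)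
  also have "\<dots> = (\<Sum>l\<le>k. \<Sum>h<r. g l h)" by (rule sum_blocks)
  also have "\<dots> = (\<Sum>h<r. \<Sum>l\<le>k. g l h)" by (rule sum.swap)
  also have "\<dots> = (\<Sum>h<r. if i \<le> j then hyperderiv (j - i) (A $$ (a, h) * B $$ (h, b)) else 0)"
  proof (rule sum.cong[OF refl])
    fix h assume "h \<in> {..<r}"
    then have h: "h < r" by simp
    show "(\<Sum>l\<le>k. g l h) = (if i \<le> j then hyperderiv (j - i) (A $$ (a, h) * B $$ (h, b)) else 0)"
    proof (cases "i \<le> j")
      case True
      have ps: "A $$ (a, h) \<in> range fps_to_fls" "B $$ (h, b) \<in> range fps_to_fls"
        by (intro elements_mat_subsetD[OF A(2,1)] elements_mat_subsetD[OF B(2,1)] ab h)+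
      have "(\<Sum>l\<le>k. g l h) = (\<Sum>l\<in>{i..j}. g l h)"
        using ij by (intro sum.mono_neutral_right) (auto simp: g_def)
      also have "\<dots> = (\<Sum>s\<le>j - i. hyperderiv s (A $$ (a, h)) * hyperderiv (j - i - s) (B $$ (h, b)))"
        using True by (intro sum.reindex_bij_witness[of _ "\<lambda>s. i + s" "\<lambda>l. l - i"])
          (auto simp: g_def)
      finally show ?thesis using True by (simp add: hyperderiv_mult[OF ps])
    qed (auto simp: g_def intro!: sum.neutral)
  qed
  also have "\<dots> = (if i \<le> j then hyperderiv (j - i) ((A * B) $$ (a, b)) else 0)"
    using ab A(1) B(1) by (simp add: scalar_prod_def atLeast0LessThan hyperderiv_sum)
  also have "\<dots> = rho k (A * B) $$ (x, y)"
    by (simp add: rho_index[OF AB x y] i_def j_def a_def b_def)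
  finally show "rho k (A * B) $$ (x, y) = (rho k A * rho k B) $$ (x, y)" ..
qed (use A B in \<open>auto simp: rho_def Let_def\<close>)

lemma rho_one: "rho k (1\<^sub>m r) = 1\<^sub>m (r * (k + 1))"
proof (rule eq_matI)
  fix x y assume "x < dim_row (1\<^sub>m (r * (k + 1)))" "y < dim_col (1\<^sub>m (r * (k + 1)))"
  then have x: "x < r * (k + 1)" and y: "y < r * (k + 1)" by auto
  have "x = y \<longleftrightarrow> x div r = y div r \<and> x mod r = y mod r"
    by (metis div_mult_mod_eq)
  then show "rho k (1\<^sub>m r) $$ (x, y) = (1\<^sub>m (r * (k + 1)) :: 'a fls mat) $$ (x, y)"
    using block_index_less[OF x] block_index_less[OF y] x y
    by (auto simp: rho_index[OF one_carrier_mat x y] hyperderiv_1)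
qed (auto simp: rho_def Let_def)

text \<open>Invertibility over \<open>S\<close> is inherited because \<open>\<rho>\<^sub>[\<^sub>k\<^sub>]\<close> maps an inverse of \<open>A\<close> to an inverse of
  \<open>\<rho>\<^sub>[\<^sub>k\<^sub>](A)\<close>.\<close>

lemma rho_GL:
  assumes "A \<in> GL r S" "S \<subseteq> range fps_to_fls" "0 \<in> S"
    and "\<And>n f. f \<in> S \<Longrightarrow> hyperderiv n f \<in> S"
  shows "rho k A \<in> GL (r * (k + 1)) S"
proof -
  obtain B where B: "B \<in> carrier_mat r r" "elements_mat B \<subseteq> S" "A * B = 1\<^sub>m r" "B * A = 1\<^sub>m r"
    and A: "A \<in> carrier_mat r r" "elements_mat A \<subseteq> S"
    using assms(1) unfolding GL_def by blast
  have "elements_mat A \<subseteq> range fps_to_fls" "elements_mat B \<subseteq> range fps_to_fls"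
    by (rule order_trans[OF A(2) assms(2)], rule order_trans[OF B(2) assms(2)])
  then have "rho k (A * B) = rho k A * rho k B" "rho k (B * A) = rho k B * rho k A"
    using rho_mult[OF A(1) _ B(1)] rho_mult[OF B(1) _ A(1)] by simp_all
  then have "rho k A * rho k B = 1\<^sub>m (r * (k + 1))" "rho k B * rho k A = 1\<^sub>m (r * (k + 1))"
    by (metis B(3) rho_one, metis B(4) rho_one)
  moreover have "elements_mat (rho k A) \<subseteq> S" "elements_mat (rho k B) \<subseteq> S"
    by (rule rho_elements[OF A assms(3,4)], assumption,
        rule rho_elements[OF B(1,2) assms(3,4)], assumption)
  ultimately show ?thesis
    using rho_carrier[OF A(1), of k] rho_carrier[OF B(1), of k] unfolding GL_def
    by (intro CollectI conjI bexI[of _ "rho k B"])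
qed

context function_field_setting
begin

lemma rho_twist:
  assumes A: "A \<in> carrier_mat r r" "elements_mat A \<subseteq> range fps_to_fls"
  shows "rho k (map_mat (twist q) A) = map_mat (twist q) (rho k (A :: 'c fls mat))"
proof (rule eq_matI)
  fix x y assume "x < dim_row (map_mat (twist q) (rho k A))" "y < dim_col (map_mat (twist q) (rho k A))"
  then have x: "x < r * (k + 1)" and y: "y < r * (k + 1)"
    using rho_carrier[OF A(1), of k] by auto
  have idx: "x mod r < r" "y mod r < r" using block_index_less x y by blast+
  have "A $$ (x mod r, y mod r) \<in> range fps_to_fls"
    by (intro elements_mat_subsetD[OF A(2,1)] idx)
  then have "twist q (hyperderiv n (A $$ (x mod r, y mod r))) =
      hyperderiv n (twist q (A $$ (x mod r, y mod r)))" for n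
    by (rule twist_hyperderiv)
  moreover have "map_mat (twist q) A \<in> carrier_mat r r" using A(1) by simp
  ultimately show "rho k (map_mat (twist q) A) $$ (x, y) = map_mat (twist q) (rho k A) $$ (x, y)"
    using x y idx A(1) rho_carrier[OF A(1), of k] by (simp add: rho_index)
qed (use A in \<open>auto simp: rho_def Let_def\<close>)

end

section \<open>Free modules, quotients and coordinates\<close>

text \<open>With pointwise addition of functions, the operations of the free module are the type-class ones, so
  that its \<open>finsum\<close> becomes an ordinary \<open>sum\<close>.\<close>

lemma free_module_on_simps [simp]:
  "carrier (free_module_on (ring_on S) Y) =
     {f. (\<forall>x. f x \<in> S) \<and> (\<forall>x. x \<notin> Y \<longrightarrow> f x = 0) \<and> finite {x. f x \<noteq> 0}}"
  "f \<oplus>\<^bsub>free_module_on (ring_on S) Y\<^esub> g = f + g"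
  "\<zero>\<^bsub>free_module_on (ring_on S) Y\<^esub> = 0"
  "a \<odot>\<^bsub>free_module_on (ring_on S) Y\<^esub> f = (\<lambda>x. a * f x)"
  by (simp_all add: free_module_on_def plus_fun_def zero_fun_def)

lemma module_free_module_on:
  fixes S :: "'a::comm_ring_1 set"
  assumes "cring (ring_on S)"
  shows "module (ring_on S) (free_module_on (ring_on S) Y)"
proof -
  interpret S: cring "ring_on S" by fact
  have closed: "0 \<in> S" "\<And>x y. x \<in> S \<Longrightarrow> y \<in> S \<Longrightarrow> x + y \<in> S" "\<And>x y. x \<in> S \<Longrightarrow> y \<in> S \<Longrightarrow> x * y \<in> S"
    using S.zero_closed S.a_closed S.m_closed by simp_all
  have neg: "- x \<in> S" if "x \<in> S" for x
    using S.a_inv_closed[of x] S.l_neg[of x] that by (simp add: eq_neg_iff_add_eq_0[symmetric])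
  let ?F = "free_module_on (ring_on S) Y"
  have ab: "abelian_group ?F"
  proof (rule abelian_groupI)
    fix x assume x: "x \<in> carrier ?F"
    then show "\<exists>y\<in>carrier ?F. y \<oplus>\<^bsub>?F\<^esub> x = \<zero>\<^bsub>?F\<^esub>"
      using neg by (intro bexI[of _ "\<lambda>i. - x i"]) (auto simp: fun_eq_iff)
  next
    fix x y assume x: "x \<in> carrier ?F" and y: "y \<in> carrier ?F"
    have "finite {i. x i + y i \<noteq> 0}"
      by (rule finite_subset[of _ "{i. x i \<noteq> 0} \<union> {i. y i \<noteq> 0}"]) (use x y in auto)
    then show "x \<oplus>\<^bsub>?F\<^esub> y \<in> carrier ?F"
      using closed x y by simp
  qed (use closed in \<open>auto simp: algebra_simps\<close>)
  show ?thesis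
  proof (rule moduleI[OF assms ab])
    fix a f assume a: "a \<in> carrier (ring_on S)" and f: "f \<in> carrier ?F"
    have "finite {i. a * f i \<noteq> 0}"
      by (rule finite_subset[of _ "{i. f i \<noteq> 0}"]) (use f in auto)
    then show "a \<odot>\<^bsub>?F\<^esub> f \<in> carrier ?F"
      using closed a f by simp
  qed (auto simp: algebra_simps fun_eq_iff)
qed

lemma finsum_free_module_on:
  fixes S :: "'a::comm_ring_1 set"
  assumes "cring (ring_on S)" "g \<in> A \<rightarrow> carrier (free_module_on (ring_on S) Y)"
  shows "finsum (free_module_on (ring_on S) Y) g A = sum g A"
proof -
  interpret F: module "ring_on S" "free_module_on (ring_on S) Y"
    by (rule module_free_module_on) fact
  show ?thesis using assms(2)
  proof (induction A rule: infinite_finite_induct)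
    case (insert x A)
    then have "finsum (free_module_on (ring_on S) Y) g (insert x A) =
        g x \<oplus>\<^bsub>free_module_on (ring_on S) Y\<^esub> finsum (free_module_on (ring_on S) Y) g A"
      by (intro F.finsum_insert) auto
    then show ?case using insert by simp
  qed simp_all
qed

lemma a_minus_free_module_on:
  fixes S :: "'a::comm_ring_1 set"
  assumes "cring (ring_on S)" "g \<in> carrier (free_module_on (ring_on S) Y)"
  shows "f \<ominus>\<^bsub>free_module_on (ring_on S) Y\<^esub> g = f - g"
proof -
  interpret F: module "ring_on S" "free_module_on (ring_on S) Y"
    by (rule module_free_module_on) fact
  have "\<ominus>\<^bsub>free_module_on (ring_on S) Y\<^esub> g + g = 0"
    using F.l_neg[OF assms(2)] by simp
  then have "\<ominus>\<^bsub>free_module_on (ring_on S) Y\<^esub> g = - g"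
    by (simp add: eq_neg_iff_add_eq_0)
  then show ?thesis by (simp add: a_minus_def)
qed

context module
begin

lemma submodule_abelian_subgroup:
  assumes "submodule N R M"
  shows "abelian_subgroup N M"
  by (rule abelian_subgroupI3[OF additive_subgroupI[OF submodule.axioms(1)[OF assms]]
        abelian_group_axioms])

lemma submodule_Inter:
  assumes "\<H> \<noteq> {}" "\<And>H. H \<in> \<H> \<Longrightarrow> submodule H R M"
  shows "submodule (\<Inter>\<H>) R M"
proof (rule submoduleI)
  show "\<zero>\<^bsub>M\<^esub> \<in> \<Inter>\<H>"
    using assms(2) abelian_subgroup.axioms(1)[OF submodule_abelian_subgroup]
    by (auto intro: additive_subgroup.zero_closed)
  show "\<Inter>\<H> \<subseteq> carrier M"
    using assms submoduleE(1) by blast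
qed (use assms(2) submoduleE(3-5) in blast)+

lemma submodule_generated_submodule:
  assumes "T \<subseteq> carrier M"
  shows "submodule (generated_submodule R M T) R M"
  unfolding generated_submodule_def
proof (rule submodule_Inter)
  show "{H. submodule H R M \<and> T \<subseteq> H} \<noteq> {}"
    using assms carrier_is_submodule by blast
qed simp

text \<open>The definition of a basis provides combinations over subsets of \<open>I\<close>; they are padded by zero
  coefficients.\<close>

lemma basis_coords_exist:
  assumes "is_basis R M I e" "finite I" "m \<in> carrier M"
  obtains c where "c \<in> I \<rightarrow> carrier R" "m = (\<Oplus>\<^bsub>M\<^esub>i\<in>I. c i \<odot>\<^bsub>M\<^esub> e i)"
proof -
  have e: "e \<in> I \<rightarrow> carrier M" using assms(1) by (simp add: is_basis_def generates_def)
  obtain F c where F: "F \<subseteq> I" and c: "c \<in> F \<rightarrow> carrier R" and m: "m = (\<Oplus>\<^bsub>M\<^esub>i\<in>F. c i \<odot>\<^bsub>M\<^esub> e i)"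
    using assms(1,3) unfolding is_basis_def generates_def by blast
  define d where "d i = (if i \<in> F then c i else \<zero>\<^bsub>R\<^esub>)" for i
  have "(\<Oplus>\<^bsub>M\<^esub>i\<in>I. d i \<odot>\<^bsub>M\<^esub> e i) = (\<Oplus>\<^bsub>M\<^esub>i\<in>F. c i \<odot>\<^bsub>M\<^esub> e i)"
    using F c e assms(2) by (intro M.add.finprod_mono_neutral_cong_right)
      (auto simp: d_def Pi_iff subset_iff)
  moreover have "d \<in> I \<rightarrow> carrier R" using c by (auto simp: d_def)
  ultimately show ?thesis using that[of d] m by simp
qed

lemma basis_coords_unique:
  assumes "is_basis R M I e" "finite I" and c: "c \<in> I \<rightarrow> carrier R" and d: "d \<in> I \<rightarrow> carrier R"
    and eq: "(\<Oplus>\<^bsub>M\<^esub>i\<in>I. c i \<odot>\<^bsub>M\<^esub> e i) = (\<Oplus>\<^bsub>M\<^esub>i\<in>I. d i \<odot>\<^bsub>M\<^esub> e i)" and i: "i \<in> I"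
  shows "c i = d i"
proof -
  have e: "e \<in> I \<rightarrow> carrier M" using assms(1) by (simp add: is_basis_def generates_def)
  define b where "b i = c i \<ominus>\<^bsub>R\<^esub> d i" for i
  have b: "b \<in> I \<rightarrow> carrier R" using c d by (auto simp: b_def Pi_iff)
  define s where "s = (\<lambda>c. \<Oplus>\<^bsub>M\<^esub>i\<in>I. c i \<odot>\<^bsub>M\<^esub> e i)"
  have s_closed: "s f \<in> carrier M" if "f \<in> I \<rightarrow> carrier R" for f
    using that e by (auto simp: s_def Pi_iff intro!: M.finsum_closed)
  have "s b \<oplus>\<^bsub>M\<^esub> s d = (\<Oplus>\<^bsub>M\<^esub>i\<in>I. b i \<odot>\<^bsub>M\<^esub> e i \<oplus>\<^bsub>M\<^esub> d i \<odot>\<^bsub>M\<^esub> e i)"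
    using b d e unfolding s_def by (intro M.finsum_addf[symmetric]) (auto simp: Pi_iff)
  also have "\<dots> = s c"
    unfolding s_def
  proof (rule M.finsum_cong')
    fix i assume "i \<in> I"
    then have "c i \<in> carrier R" "d i \<in> carrier R" "b i \<in> carrier R" "e i \<in> carrier M"
      using b c d e by auto
    moreover from this have "b i \<oplus>\<^bsub>R\<^esub> d i = c i"
      by (simp add: b_def a_minus_def R.a_assoc R.l_neg)
    ultimately show "b i \<odot>\<^bsub>M\<^esub> e i \<oplus>\<^bsub>M\<^esub> d i \<odot>\<^bsub>M\<^esub> e i = c i \<odot>\<^bsub>M\<^esub> e i"
      by (simp flip: smult_l_distr)
  qed (use c e in \<open>auto simp: Pi_iff\<close>)
  also have "\<dots> = \<zero>\<^bsub>M\<^esub> \<oplus>\<^bsub>M\<^esub> s d"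
    using eq s_closed[OF d] by (simp add: s_def)
  finally have "s b = \<zero>\<^bsub>M\<^esub>"
    using s_closed[OF b] s_closed[OF d] by (simp add: M.add.right_cancel)
  then have "b i = \<zero>\<^bsub>R\<^esub>"
    using assms(1,2) b i unfolding is_basis_def linearly_independent_def s_def by blast
  moreover have "c i \<in> carrier R" "d i \<in> carrier R" using c d i by auto
  ultimately show ?thesis by (simp add: b_def)
qed

end

locale module_quotient = module R M for R :: "('a, 'd) ring_scheme" and M :: "('a, 'b) module" (structure) +
  fixes N :: "'b set"
  assumes N: "submodule N R M"
begin

lemma quotient_module_simps [simp]:
  "carrier (quotient_module M N) = (\<lambda>x. N +>\<^bsub>M\<^esub> x) ` carrier M"
  "\<zero>\<^bsub>quotient_module M N\<^esub> = N"
  by (auto simp: quotient_module_def A_RCOSETS_def')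

lemma coset_eqI:
  assumes x: "x \<in> carrier M" and y: "y \<in> carrier M"
    and "x \<ominus>\<^bsub>M\<^esub> y \<in> N"
  shows "N +>\<^bsub>M\<^esub> x = N +>\<^bsub>M\<^esub> y"
proof -
  interpret N: abelian_subgroup N M by (rule submodule_abelian_subgroup[OF N])
  have "x \<in> N +>\<^bsub>M\<^esub> y"
    using N.a_rcos_module_rev[OF y x] assms(3) by (simp add: a_minus_def)
  then show ?thesis
    using a_repr_independence[OF _ y N.a_subgroup] by simp
qed

lemma mem_coset_minus:
  assumes x: "x \<in> carrier M" and z: "z \<in> N +>\<^bsub>M\<^esub> x"
  shows "z \<in> carrier M" "z \<ominus>\<^bsub>M\<^esub> x \<in> N"
proof -
  interpret N: abelian_subgroup N M by (rule submodule_abelian_subgroup[OF N])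
  show "z \<in> carrier M" using N.a_elemrcos_carrier[OF x z] .
  show "z \<ominus>\<^bsub>M\<^esub> x \<in> N" using N.a_rcos_module_imp[OF x z] by (simp add: a_minus_def)
qed

lemma mem_own_coset:
  assumes x: "x \<in> carrier M"
  shows "x \<in> N +>\<^bsub>M\<^esub> x"
  using abelian_subgroup.a_rcos_self[OF submodule_abelian_subgroup[OF N] x] .

lemma coset_eq_kernel_iff:
  assumes x: "x \<in> carrier M"
  shows "N +>\<^bsub>M\<^esub> x = N \<longleftrightarrow> x \<in> N"
proof
  assume "N +>\<^bsub>M\<^esub> x = N"
  with mem_own_coset[OF x] show "x \<in> N" by (simp only:)
next
  assume "x \<in> N"
  then show "N +>\<^bsub>M\<^esub> x = N"
    by (rule abelian_subgroup.a_rcos_const[OF submodule_abelian_subgroup[OF N]])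
qed

text \<open>A map that respects the cosets of \<open>N\<close> has the same value on all representatives, so that
  the union over representatives in the definitions of the quotient operations collapses.\<close>

lemma coset_UN_eq:
  assumes x: "x \<in> carrier M"
    and closed: "\<And>y. y \<in> carrier M \<Longrightarrow> g y \<in> carrier M"
    and resp: "\<And>y. y \<in> carrier M \<Longrightarrow> y \<ominus>\<^bsub>M\<^esub> x \<in> N \<Longrightarrow> g y \<ominus>\<^bsub>M\<^esub> g x \<in> N"
  shows "(\<Union>y\<in>N +>\<^bsub>M\<^esub> x. N +>\<^bsub>M\<^esub> g y) = N +>\<^bsub>M\<^esub> g x"
proof (rule UN_constant_eq[OF mem_own_coset[OF x]])
  show "\<forall>y\<in>N +>\<^bsub>M\<^esub> x. N +>\<^bsub>M\<^esub> g y = N +>\<^bsub>M\<^esub> g x"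
    using mem_coset_minus[OF x] by (intro ballI coset_eqI closed resp x)
qed

lemma quotient_module_smult:
  assumes a: "a \<in> carrier R" and x: "x \<in> carrier M"
  shows "a \<odot>\<^bsub>quotient_module M N\<^esub> (N +>\<^bsub>M\<^esub> x) = N +>\<^bsub>M\<^esub> (a \<odot>\<^bsub>M\<^esub> x)"
proof -
  have "a \<odot>\<^bsub>M\<^esub> y \<ominus>\<^bsub>M\<^esub> a \<odot>\<^bsub>M\<^esub> x = a \<odot>\<^bsub>M\<^esub> (y \<ominus>\<^bsub>M\<^esub> x)" if "y \<in> carrier M" for y
    using a x that by (simp add: a_minus_def smult_r_distr smult_r_minus)
  then show ?thesis
    unfolding quotient_module_def using a x submoduleE(4)[OF N]
    by (simp add: coset_UN_eq[OF x])
qed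

lemma quotient_module_abelian_monoid:
  shows "abelian_monoid (quotient_module M N)"
proof -
  interpret Q: comm_group "add_monoid M Mod N"
    by (rule comm_group.abelian_FactGroup[OF a_comm_group submodule.axioms(1)[OF N]])
  have eqs: "carrier (quotient_module M N) = carrier (add_monoid M Mod N)"
    "\<zero>\<^bsub>quotient_module M N\<^esub> = \<one>\<^bsub>add_monoid M Mod N\<^esub>"
    "add (quotient_module M N) = monoid.mult (add_monoid M Mod N)"
    by (simp_all only: quotient_module_def FactGroup_def A_RCOSETS_def set_add_def
        partial_object.simps monoid.simps ring.simps)
  show ?thesis
    by (rule abelian_monoidI; unfold eqs)
      (rule Q.m_closed Q.one_closed Q.m_assoc Q.l_one Q.m_comm; assumption?)+
qed

lemma finsum_quotient_module:
  assumes "g \<in> A \<rightarrow> carrier M"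
  shows "(\<Oplus>\<^bsub>quotient_module M N\<^esub>i\<in>A. N +>\<^bsub>M\<^esub> g i) = N +>\<^bsub>M\<^esub> (\<Oplus>\<^bsub>M\<^esub>i\<in>A. g i)"
proof -
  interpret Q: abelian_monoid "quotient_module M N"
    by (rule quotient_module_abelian_monoid)
  interpret N: abelian_subgroup N M by (rule submodule_abelian_subgroup[OF N])
  have zero: "N +>\<^bsub>M\<^esub> \<zero>\<^bsub>M\<^esub> = N"
    using coset_eq_kernel_iff[OF M.zero_closed] N.zero_closed by simp
  show ?thesis using assms
  proof (induction A rule: infinite_finite_induct)
    case (insert x A)
    have "(\<Oplus>\<^bsub>quotient_module M N\<^esub>i\<in>insert x A. N +>\<^bsub>M\<^esub> g i) =
        (N +>\<^bsub>M\<^esub> g x) \<oplus>\<^bsub>quotient_module M N\<^esub> (\<Oplus>\<^bsub>quotient_module M N\<^esub>i\<in>A. N +>\<^bsub>M\<^esub> g i)"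
      using insert by (intro Q.finsum_insert) auto
    also have "\<dots> = (N +>\<^bsub>M\<^esub> g x) \<oplus>\<^bsub>quotient_module M N\<^esub> (N +>\<^bsub>M\<^esub> (\<Oplus>\<^bsub>M\<^esub>i\<in>A. g i))"
      using insert by simp
    also have "\<dots> = N +>\<^bsub>M\<^esub> (g x \<oplus>\<^bsub>M\<^esub> (\<Oplus>\<^bsub>M\<^esub>i\<in>A. g i))"
      using insert N.a_rcos_sum[of "g x" "\<Oplus>\<^bsub>M\<^esub>i\<in>A. g i"]
      by (simp add: quotient_module_def Pi_iff)
    also have "g x \<oplus>\<^bsub>M\<^esub> (\<Oplus>\<^bsub>M\<^esub>i\<in>A. g i) = (\<Oplus>\<^bsub>M\<^esub>i\<in>insert x A. g i)"
      using insert by (intro M.finsum_insert[symmetric]) auto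
    finally show ?case .
  qed (use zero in simp_all)
qed

end

section \<open>The free module on the symbols\<close>

lemma sum_fun_apply: "(sum g A) x = (\<Sum>i\<in>A. g i x)"
  by (induction A rule: infinite_finite_induct) simp_all

lemma support_sum_superset:
  fixes \<phi> :: "'x \<Rightarrow> 'a::zero \<Rightarrow> 'b::comm_monoid_add"
  assumes "finite A" "{x. f x \<noteq> 0} \<subseteq> A" "\<And>x. \<phi> x 0 = 0"
  shows "(\<Sum>x | f x \<noteq> 0. \<phi> x (f x)) = (\<Sum>x\<in>A. \<phi> x (f x))"
  using assms by (intro sum.mono_neutral_left) auto

text \<open>Sums over the support of a function are additive although the support of \<open>f + g\<close> may be smaller
  than the union of the supports: all three sums may be taken over that union.\<close>

lemma support_sum_add:
  fixes \<phi> :: "'x \<Rightarrow> 'a::ab_group_add \<Rightarrow> 'b::comm_monoid_add"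
  assumes f: "finite {x. f x \<noteq> 0}" and g: "finite {x. g x \<noteq> 0}"
    and \<phi>: "\<And>x. \<phi> x 0 = 0" "\<And>x a b. \<phi> x (a + b) = \<phi> x a + \<phi> x b"
  shows "(\<Sum>x | (f + g) x \<noteq> 0. \<phi> x ((f + g) x)) =
    (\<Sum>x | f x \<noteq> 0. \<phi> x (f x)) + (\<Sum>x | g x \<noteq> 0. \<phi> x (g x))"
proof -
  define A where "A = {x. f x \<noteq> 0} \<union> {x. g x \<noteq> 0}"
  have A: "finite A" "{x. f x \<noteq> 0} \<subseteq> A" "{x. g x \<noteq> 0} \<subseteq> A" "{x. (f + g) x \<noteq> 0} \<subseteq> A"
    using f g by (auto simp: A_def)
  show ?thesis
    unfolding support_sum_superset[where \<phi> = \<phi>, OF A(1,2) \<phi>(1)]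
      support_sum_superset[where \<phi> = \<phi>, OF A(1,3) \<phi>(1)]
      support_sum_superset[where \<phi> = \<phi>, OF A(1,4) \<phi>(1)]
    by (simp add: \<phi>(2) sum.distrib)
qed

text \<open>The linear extension to the free module of a function \<open>w\<close> on its basis.\<close>

definition pairing :: "('x \<Rightarrow> 'a::comm_ring_1) \<Rightarrow> ('x \<Rightarrow> 'a) \<Rightarrow> 'a" where
  "pairing w f = (\<Sum>x | f x \<noteq> 0. f x * w x)"

lemma pairing_0 [simp]: "pairing w 0 = 0"
  by (simp add: pairing_def)

lemma pairing_add:
  "finite {x. f x \<noteq> 0} \<Longrightarrow> finite {x. g x \<noteq> 0} \<Longrightarrow> pairing w (f + g) = pairing w f + pairing w g"
  unfolding pairing_def by (rule support_sum_add) (auto simp: algebra_simps)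

lemma pairing_smult:
  assumes "finite {x. f x \<noteq> 0}"
  shows "pairing w (\<lambda>x. a * f x) = a * pairing w f"
proof -
  have "pairing w (\<lambda>x. a * f x) = (\<Sum>x | f x \<noteq> 0. a * f x * w x)"
    unfolding pairing_def by (rule support_sum_superset[where \<phi> = "\<lambda>x b. b * w x"]) (use assms in auto)
  then show ?thesis by (simp add: pairing_def sum_distrib_left mult.assoc)
qed

lemma D_symbol_support: "{x. D_symbol i m x \<noteq> (0 :: 'c::field fls)} = {(i, m)}"
  by (auto simp: D_symbol_def)

lemma pairing_D_symbol: "pairing w (D_symbol i m) = w (i, m)"
  unfolding pairing_def D_symbol_support by (simp add: D_symbol_def)

lemma (in function_field_setting) skew_mult_const:
  "skew_mult q [:a:] [:b:] = [:a * b :: 'c fls:]"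
  by (simp add: skew_mult_def monom_0)

lemma (in function_field_setting) skew_mult_sigma_const:
  "skew_mult q (Polynomial.monom 1 1) [:a :: 'c fls:] = Polynomial.monom (twist q a) 1"
  by (simp add: skew_mult_def degree_monom_eq atMost_Suc)

lemma (in function_field_setting) skew_mult_const_sigma:
  "skew_mult q [:a :: 'c fls:] (Polynomial.monom 1 1) = Polynomial.monom a 1"
  by (simp add: skew_mult_def degree_monom_eq atMost_Suc)

locale prolonged_module = function_field_setting q Fq \<theta> K absv
  for q :: nat and Fq :: "'c::field set" and \<theta> :: 'c and K :: "'c set" and absv :: "'c \<Rightarrow> real" +
  fixes M :: "('c fls poly, 'm) module" and k :: nat
  assumes left_module: "left_module (skew_poly_ring q (Kbar_t K)) M"
begin

abbreviation "S \<equiv> Kbar_t K"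
abbreviation "RM \<equiv> restrict_scalars M"
abbreviation "F \<equiv> (symbols_module K k M :: ('c fls, nat \<times> 'm \<Rightarrow> 'c fls) module)"
abbreviation "N \<equiv> prolongation_kernel K k M"

interpretation L: left_module "skew_poly_ring q S" M
  by (rule left_module)

lemma S_closed:
  "0 \<in> S" "1 \<in> S" "x \<in> S \<Longrightarrow> y \<in> S \<Longrightarrow> x + y \<in> S" "x \<in> S \<Longrightarrow> y \<in> S \<Longrightarrow> x * y \<in> S"
proof -
  interpret S: cring "ring_on S" by (rule cring_Kbar_t)
  show "0 \<in> S" "1 \<in> S" "x \<in> S \<Longrightarrow> y \<in> S \<Longrightarrow> x + y \<in> S" "x \<in> S \<Longrightarrow> y \<in> S \<Longrightarrow> x * y \<in> S"
    using S.zero_closed S.one_closed S.a_closed[of x y] S.m_closed[of x y] by simp_all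
qed

lemma S_sum: "(\<And>x. x \<in> A \<Longrightarrow> f x \<in> S) \<Longrightarrow> sum f A \<in> S"
  by (induction A rule: infinite_finite_induct) (auto simp: S_closed)

lemma S_power_series: "a \<in> S \<Longrightarrow> a \<in> range fps_to_fls"
  using Kbar_t_power_series by blast

lemma skew_poly_ring_simps [simp]:
  "carrier (skew_poly_ring q S) = {f. \<forall>i. Polynomial.coeff f i \<in> S}"
  "x \<otimes>\<^bsub>skew_poly_ring q S\<^esub> y = skew_mult q x y"
  "x \<oplus>\<^bsub>skew_poly_ring q S\<^esub> y = x + y"
  "\<one>\<^bsub>skew_poly_ring q S\<^esub> = 1"
  by (simp_all add: skew_poly_ring_def)

lemma const_in_skew_poly_ring: "a \<in> S \<Longrightarrow> [:a:] \<in> carrier (skew_poly_ring q S)"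
  using S_closed(1) by (auto simp: coeff_pCons split: nat.split)

lemma sigma_in_skew_poly_ring: "Polynomial.monom 1 1 \<in> carrier (skew_poly_ring q S)"
  using S_closed(1,2) by (auto simp: coeff_monom)

text \<open>That the \<open>q\<close>-th root of an element of \<open>Kbar\<close> lies again in \<open>Kbar\<close> is read off from the module
  structure: \<open>Kbar[t]{\<sigma>}\<close> is closed under multiplication and \<open>\<sigma> a = a\<^sup>\<sigma> \<sigma>\<close>.\<close>

lemma twist_closed:
  assumes "a \<in> S"
  shows "twist q a \<in> S"
proof -
  have "Polynomial.monom 1 1 \<otimes>\<^bsub>skew_poly_ring q S\<^esub> [:a:] \<in> carrier (skew_poly_ring q S)"
    by (rule L.R.m_closed[OF sigma_in_skew_poly_ring const_in_skew_poly_ring[OF assms]])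
  then have "Polynomial.coeff (Polynomial.monom (twist q a) 1) 1 \<in> S"
    unfolding skew_poly_ring_simps skew_mult_sigma_const by blast
  then show ?thesis by simp
qed

lemma restrict_scalars_simps [simp]:
  "carrier RM = carrier M" "x \<oplus>\<^bsub>RM\<^esub> y = x \<oplus>\<^bsub>M\<^esub> y" "\<zero>\<^bsub>RM\<^esub> = \<zero>\<^bsub>M\<^esub>"
  "a \<odot>\<^bsub>RM\<^esub> m = [:a:] \<odot>\<^bsub>M\<^esub> m"
  by (simp_all add: restrict_scalars_def)

lemma restrict_scalars_module: "module (ring_on S) RM"
proof (rule moduleI[OF cring_Kbar_t])
  show "abelian_group RM"
    by (rule abelian_groupI)
      (auto simp: L.M.a_ac intro: L.M.a_closed L.M.l_neg bexI[of _ "\<ominus>\<^bsub>M\<^esub> _"])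
next
  fix a b m assume "a \<in> carrier (ring_on S)" "b \<in> carrier (ring_on S)" "m \<in> carrier RM"
  then have m: "m \<in> carrier M"
    and ab: "[:a:] \<in> carrier (skew_poly_ring q S)" "[:b:] \<in> carrier (skew_poly_ring q S)"
    using const_in_skew_poly_ring by simp_all
  show "(a \<oplus>\<^bsub>ring_on S\<^esub> b) \<odot>\<^bsub>RM\<^esub> m = a \<odot>\<^bsub>RM\<^esub> m \<oplus>\<^bsub>RM\<^esub> b \<odot>\<^bsub>RM\<^esub> m"
    using L.smult_l_distr[OF ab m] by simp
  show "(a \<otimes>\<^bsub>ring_on S\<^esub> b) \<odot>\<^bsub>RM\<^esub> m = a \<odot>\<^bsub>RM\<^esub> (b \<odot>\<^bsub>RM\<^esub> m)"
    using L.smult_assoc[OF ab m] by (simp add: skew_mult_const)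
next
  fix a m assume "a \<in> carrier (ring_on S)" "m \<in> carrier RM"
  then show "a \<odot>\<^bsub>RM\<^esub> m \<in> carrier RM"
    using L.smult_closed[OF const_in_skew_poly_ring] by simp
next
  fix a m n assume "a \<in> carrier (ring_on S)" "m \<in> carrier RM" "n \<in> carrier RM"
  then show "a \<odot>\<^bsub>RM\<^esub> (m \<oplus>\<^bsub>RM\<^esub> n) = a \<odot>\<^bsub>RM\<^esub> m \<oplus>\<^bsub>RM\<^esub> a \<odot>\<^bsub>RM\<^esub> n"
    using L.smult_r_distr[OF const_in_skew_poly_ring] by simp
next
  fix m assume "m \<in> carrier RM"
  then show "\<one>\<^bsub>ring_on S\<^esub> \<odot>\<^bsub>RM\<^esub> m = m"
    using L.smult_one[of m] by (simp add: one_pCons)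
qed

sublocale RM: module "ring_on S" RM
  by (rule restrict_scalars_module)

lemma sigma_closed: "m \<in> carrier M \<Longrightarrow> sigma M m \<in> carrier M"
  unfolding sigma_def by (rule L.smult_closed[OF sigma_in_skew_poly_ring])

lemma sigma_add:
  "m \<in> carrier M \<Longrightarrow> n \<in> carrier M \<Longrightarrow> sigma M (m \<oplus>\<^bsub>M\<^esub> n) = sigma M m \<oplus>\<^bsub>M\<^esub> sigma M n"
  unfolding sigma_def by (rule L.smult_r_distr[OF sigma_in_skew_poly_ring])

text \<open>\<open>\<sigma>(a m) = (\<sigma> a) m = (a\<^sup>\<sigma> \<sigma>) m\<close>.\<close>

lemma sigma_smult:
  assumes "a \<in> S" "m \<in> carrier M"
  shows "sigma M (a \<odot>\<^bsub>RM\<^esub> m) = twist q a \<odot>\<^bsub>RM\<^esub> sigma M m"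
proof -
  let ?\<sigma> = "Polynomial.monom 1 1 :: 'c fls poly"
  have "?\<sigma> \<odot>\<^bsub>M\<^esub> ([:a:] \<odot>\<^bsub>M\<^esub> m) = skew_mult q ?\<sigma> [:a:] \<odot>\<^bsub>M\<^esub> m"
    using L.smult_assoc[OF sigma_in_skew_poly_ring const_in_skew_poly_ring[OF assms(1)] assms(2)]
    by simp
  also have "\<dots> = skew_mult q [:twist q a:] ?\<sigma> \<odot>\<^bsub>M\<^esub> m"
    by (simp only: skew_mult_sigma_const skew_mult_const_sigma)
  also have "\<dots> = [:twist q a:] \<odot>\<^bsub>M\<^esub> (?\<sigma> \<odot>\<^bsub>M\<^esub> m)"
    using L.smult_assoc[OF const_in_skew_poly_ring[OF twist_closed[OF assms(1)]]
        sigma_in_skew_poly_ring assms(2)] by simp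
  finally show ?thesis by (simp add: sigma_def)
qed

lemma F_carrier:
  "carrier F = {f. (\<forall>x. f x \<in> S) \<and> (\<forall>x. x \<notin> {..k} \<times> carrier M \<longrightarrow> f x = 0) \<and> finite {x. f x \<noteq> 0}}"
  by (simp add: symbols_module_def)

lemma F_simps [simp]:
  "f \<oplus>\<^bsub>F\<^esub> g = f + g" "\<zero>\<^bsub>F\<^esub> = 0" "a \<odot>\<^bsub>F\<^esub> f = (\<lambda>x. a * f x)"
  by (simp_all add: symbols_module_def)

lemma symbols_module_module: "module (ring_on S) F"
  unfolding symbols_module_def by (rule module_free_module_on[OF cring_Kbar_t])

sublocale F: module "ring_on S" F
  by (rule symbols_module_module)

lemma F_finsum: "g \<in> A \<rightarrow> carrier F \<Longrightarrow> finsum F g A = sum g A"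
  unfolding symbols_module_def by (rule finsum_free_module_on[OF cring_Kbar_t])

lemma F_minus: "g \<in> carrier F \<Longrightarrow> f \<ominus>\<^bsub>F\<^esub> g = f - g"
  unfolding symbols_module_def by (rule a_minus_free_module_on[OF cring_Kbar_t])

lemma F_closed:
  "f \<in> carrier F \<Longrightarrow> g \<in> carrier F \<Longrightarrow> f + g \<in> carrier F"
  "a \<in> S \<Longrightarrow> f \<in> carrier F \<Longrightarrow> (\<lambda>x. a * f x) \<in> carrier F"
  "0 \<in> carrier F"
  using F.M.a_closed[of f g] F.smult_closed[of a f] F.M.zero_closed by simp_all

lemma F_sum: "g \<in> A \<rightarrow> carrier F \<Longrightarrow> sum g A \<in> carrier F"
  using F.finsum_closed[of g A] F_finsum[of g A] by simp

lemma F_diff: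
  assumes "f \<in> carrier F" "g \<in> carrier F"
  shows "f - g \<in> carrier F"
  using F.M.minus_closed[OF assms] F_minus[OF assms(2), of f] by simp

lemma F_finite_support: "f \<in> carrier F \<Longrightarrow> finite {x. f x \<noteq> 0}"
  by (simp add: F_carrier)

lemma F_coeff: "f \<in> carrier F \<Longrightarrow> f x \<in> S"
  by (cases x) (simp add: F_carrier)

lemma F_support: "f \<in> carrier F \<Longrightarrow> f x \<noteq> 0 \<Longrightarrow> fst x \<le> k \<and> snd x \<in> carrier M"
  by (cases x) (auto simp: F_carrier)

lemma D_symbol_closed:
  "i \<le> k \<Longrightarrow> m \<in> carrier M \<Longrightarrow> D_symbol i m \<in> carrier F"
  using S_closed(1,2) D_symbol_support[of i m] by (auto simp: D_symbol_def F_carrier)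

lemma smult_D_symbol_closed:
  "a \<in> S \<Longrightarrow> i \<le> k \<Longrightarrow> m \<in> carrier M \<Longrightarrow> (\<lambda>x. a * D_symbol i m x) \<in> carrier F"
  by (rule F_closed(2)[OF _ D_symbol_closed])

lemma F_expand:
  assumes "f \<in> carrier F"
  shows "f = (\<Sum>x | f x \<noteq> 0. (\<lambda>y. f x * D_symbol (fst x) (snd x) y))"
proof
  fix y
  have "(\<Sum>x | f x \<noteq> 0. f x * D_symbol (fst x) (snd x) y) = (\<Sum>x | f x \<noteq> 0. if x = y then f x else 0)"
    by (intro sum.cong refl) (auto simp: D_symbol_def)
  also have "\<dots> = f y"
    using F_finite_support[OF assms] by (simp add: sum.delta')
  finally show "f y = (\<Sum>x | f x \<noteq> 0. (\<lambda>y. f x * D_symbol (fst x) (snd x) y)) y"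
    by (simp add: sum_fun_apply)
qed

end

section \<open>The kernel of the prolongation and the descent of \<open>\<sigma>\<close>\<close>

context prolonged_module
begin

abbreviation leibniz_sum :: "nat \<Rightarrow> 'c fls \<Rightarrow> 'm \<Rightarrow> (nat \<times> 'm \<Rightarrow> 'c fls)" where
  "leibniz_sum i a m \<equiv> (\<Sum>j\<le>i. (\<lambda>x. hyperderiv j a * D_symbol (i - j) m x))"

lemma leibniz_sum_closed:
  "i \<le> k \<Longrightarrow> a \<in> S \<Longrightarrow> m \<in> carrier M \<Longrightarrow> leibniz_sum i a m \<in> carrier F"
  by (intro F_sum funcsetI smult_D_symbol_closed Kbar_t_hyperderiv) auto

text \<open>In the pointwise operations of functions, membership of relators in a submodule becomes ordinary
  arithmetic.\<close>

lemma relators_eq: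
  "prolongation_relators K k M =
     {D_symbol i (m1 \<oplus>\<^bsub>M\<^esub> m2) - (D_symbol i m1 + D_symbol i m2) | i m1 m2.
        i \<le> k \<and> m1 \<in> carrier M \<and> m2 \<in> carrier M} \<union>
     {D_symbol i (a \<odot>\<^bsub>RM\<^esub> m) - leibniz_sum i a m | i a m.
        i \<le> k \<and> a \<in> S \<and> m \<in> carrier M}"
proof -
  have 1: "D_symbol i (m1 \<oplus>\<^bsub>M\<^esub> m2) \<ominus>\<^bsub>F\<^esub> (D_symbol i m1 \<oplus>\<^bsub>F\<^esub> D_symbol i m2) =
      D_symbol i (m1 \<oplus>\<^bsub>M\<^esub> m2) - (D_symbol i m1 + D_symbol i m2)"
    if "i \<le> k" "m1 \<in> carrier M" "m2 \<in> carrier M" for i m1 m2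
    using F_minus[OF F_closed(1)[OF D_symbol_closed D_symbol_closed]] that by simp
  have 2: "D_symbol i (a \<odot>\<^bsub>RM\<^esub> m) \<ominus>\<^bsub>F\<^esub> (\<Oplus>\<^bsub>F\<^esub>j\<in>{..i}. hyperderiv j a \<odot>\<^bsub>F\<^esub> D_symbol (i - j) m) =
      D_symbol i (a \<odot>\<^bsub>RM\<^esub> m) - leibniz_sum i a m"
    if "i \<le> k" "a \<in> S" "m \<in> carrier M" for i a m
  proof -
    have "(\<lambda>j. hyperderiv j a \<odot>\<^bsub>F\<^esub> D_symbol (i - j) m) \<in> {..i} \<rightarrow> carrier F"
      using that unfolding F_simps(3)
      by (intro funcsetI smult_D_symbol_closed Kbar_t_hyperderiv) auto
    then have "(\<Oplus>\<^bsub>F\<^esub>j\<in>{..i}. hyperderiv j a \<odot>\<^bsub>F\<^esub> D_symbol (i - j) m) = leibniz_sum i a m"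
      unfolding F_finsum F_simps(3) by (rule F_finsum)
    then show ?thesis
      using F_minus[OF leibniz_sum_closed[OF that]] by (simp only:)
  qed
  have "prolongation_relators K k M =
     {D_symbol i (m1 \<oplus>\<^bsub>M\<^esub> m2) \<ominus>\<^bsub>F\<^esub> (D_symbol i m1 \<oplus>\<^bsub>F\<^esub> D_symbol i m2) | i m1 m2.
        i \<le> k \<and> m1 \<in> carrier M \<and> m2 \<in> carrier M} \<union>
     {D_symbol i (a \<odot>\<^bsub>RM\<^esub> m) \<ominus>\<^bsub>F\<^esub> (\<Oplus>\<^bsub>F\<^esub>j\<in>{..i}. hyperderiv j a \<odot>\<^bsub>F\<^esub> D_symbol (i - j) m) | i a m.
        i \<le> k \<and> a \<in> S \<and> m \<in> carrier M}"
    by (simp only: prolongation_relators_def Let_def)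
  also have "\<dots> = {D_symbol i (m1 \<oplus>\<^bsub>M\<^esub> m2) - (D_symbol i m1 + D_symbol i m2) | i m1 m2.
        i \<le> k \<and> m1 \<in> carrier M \<and> m2 \<in> carrier M} \<union>
     {D_symbol i (a \<odot>\<^bsub>RM\<^esub> m) - leibniz_sum i a m | i a m.
        i \<le> k \<and> a \<in> S \<and> m \<in> carrier M}"
    by (intro arg_cong2[of _ _ _ _ "(\<union>)"] Collect_cong ex_cong1 rev_conj_cong refl)
      (simp_all only: 1 2)
  finally show ?thesis .
qed

lemma relators_closed: "prolongation_relators K k M \<subseteq> carrier F"
proof
  fix f assume "f \<in> prolongation_relators K k M"
  then consider i m1 m2 where "f = D_symbol i (m1 \<oplus>\<^bsub>M\<^esub> m2) - (D_symbol i m1 + D_symbol i m2)"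
      "i \<le> k" "m1 \<in> carrier M" "m2 \<in> carrier M"
    | i a m where "f = D_symbol i (a \<odot>\<^bsub>RM\<^esub> m) - leibniz_sum i a m"
      "i \<le> k" "a \<in> S" "m \<in> carrier M"
    unfolding relators_eq by blast
  then show "f \<in> carrier F"
  proof cases
    case 1
    then have "m1 \<oplus>\<^bsub>M\<^esub> m2 \<in> carrier M" using RM.M.a_closed[of m1 m2] by simp
    then show ?thesis
      unfolding 1(1) by (intro F_diff F_closed(1) D_symbol_closed 1(2-4))
  next
    case 2
    then have "a \<odot>\<^bsub>RM\<^esub> m \<in> carrier M" using RM.smult_closed[of a m] by simp
    then show ?thesis
      unfolding 2(1) by (intro F_diff leibniz_sum_closed D_symbol_closed 2(2-4))
  qed
qed

lemma kernel_submodule: "submodule N (ring_on S) F"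
  unfolding prolongation_kernel_def by (rule F.submodule_generated_submodule[OF relators_closed])

text \<open>This is how maps on the free module are shown to descend to the prolongation: \<open>H\<close> will be the set
  of elements that the map sends to zero, or into the kernel.\<close>

lemma kernel_minimal:
  assumes "submodule H (ring_on S) F"
    and "\<And>i m1 m2. i \<le> k \<Longrightarrow> m1 \<in> carrier M \<Longrightarrow> m2 \<in> carrier M \<Longrightarrow>
      D_symbol i (m1 \<oplus>\<^bsub>M\<^esub> m2) - (D_symbol i m1 + D_symbol i m2) \<in> H"
    and "\<And>i a m. i \<le> k \<Longrightarrow> a \<in> S \<Longrightarrow> m \<in> carrier M \<Longrightarrow>
      D_symbol i (a \<odot>\<^bsub>RM\<^esub> m) - leibniz_sum i a m \<in> H"
  shows "N \<subseteq> H"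
proof -
  have "prolongation_relators K k M \<subseteq> H"
    unfolding relators_eq using assms(2,3) by blast
  then show ?thesis
    unfolding prolongation_kernel_def generated_submodule_def using assms(1) by blast
qed

lemma relators_in_kernel:
  "i \<le> k \<Longrightarrow> m1 \<in> carrier M \<Longrightarrow> m2 \<in> carrier M \<Longrightarrow>
     D_symbol i (m1 \<oplus>\<^bsub>M\<^esub> m2) - (D_symbol i m1 + D_symbol i m2) \<in> N"
  "i \<le> k \<Longrightarrow> a \<in> S \<Longrightarrow> m \<in> carrier M \<Longrightarrow>
     D_symbol i (a \<odot>\<^bsub>RM\<^esub> m) - leibniz_sum i a m \<in> N"
proof -
  have "prolongation_relators K k M \<subseteq> N"
    unfolding prolongation_kernel_def generated_submodule_def by blast
  then show "i \<le> k \<Longrightarrow> m1 \<in> carrier M \<Longrightarrow> m2 \<in> carrier M \<Longrightarrow>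
     D_symbol i (m1 \<oplus>\<^bsub>M\<^esub> m2) - (D_symbol i m1 + D_symbol i m2) \<in> N"
  "i \<le> k \<Longrightarrow> a \<in> S \<Longrightarrow> m \<in> carrier M \<Longrightarrow>
     D_symbol i (a \<odot>\<^bsub>RM\<^esub> m) - leibniz_sum i a m \<in> N"
    unfolding relators_eq by blast+
qed

sublocale Q: module_quotient "ring_on S" F N
  by (rule module_quotient.intro[OF symbols_module_module
        module_quotient_axioms.intro[OF kernel_submodule]])

lemma kernel_carrier: "f \<in> N \<Longrightarrow> f \<in> carrier F"
  using F.submoduleE(1)[OF kernel_submodule] by blast

lemma kernel_closed:
  "0 \<in> N" "f \<in> N \<Longrightarrow> g \<in> N \<Longrightarrow> f + g \<in> N" "a \<in> S \<Longrightarrow> f \<in> N \<Longrightarrow> (\<lambda>x. a * f x) \<in> N"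
  "f \<in> N \<Longrightarrow> - f \<in> N"
proof -
  interpret N: abelian_subgroup N F
    by (rule F.submodule_abelian_subgroup[OF kernel_submodule])
  show zero: "0 \<in> N" using N.zero_closed by simp
  show "f \<in> N \<Longrightarrow> g \<in> N \<Longrightarrow> f + g \<in> N" using N.a_closed[of f g] by simp
  show "a \<in> S \<Longrightarrow> f \<in> N \<Longrightarrow> (\<lambda>x. a * f x) \<in> N"
    using F.submoduleE(4)[OF kernel_submodule, of a f] by simp
  show "- f \<in> N" if "f \<in> N"
    using F.submoduleE(3)[OF kernel_submodule that] F_minus[OF kernel_carrier[OF that], of 0]
      F.M.minus_closed[of 0 f] kernel_carrier[OF that] F.M.l_zero[of "\<ominus>\<^bsub>F\<^esub> f"]
    by (simp add: a_minus_def)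
qed

lemma kernel_sum: "(\<And>x. x \<in> A \<Longrightarrow> g x \<in> N) \<Longrightarrow> sum g A \<in> N"
  by (induction A rule: infinite_finite_induct) (auto simp: kernel_closed)

lemma coset_eq:
  assumes "f \<in> carrier F" "g \<in> carrier F" "f - g \<in> N"
  shows "N +>\<^bsub>F\<^esub> f = N +>\<^bsub>F\<^esub> g"
  using Q.coset_eqI[OF assms(1,2)] assms(3) F_minus[OF assms(2), of f] by simp

text \<open>A weight function on the symbols defines a functional on the prolongation as soon as it is
  additive in \<open>m\<close> and satisfies the Leibniz rule in \<open>a \<cdot> m\<close>.\<close>

lemma pairing_kernel:
  assumes additive: "\<And>i m1 m2. i \<le> k \<Longrightarrow> m1 \<in> carrier M \<Longrightarrow> m2 \<in> carrier M \<Longrightarrow>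
      w (i, m1 \<oplus>\<^bsub>M\<^esub> m2) = w (i, m1) + w (i, m2)"
    and leibniz: "\<And>i a m. i \<le> k \<Longrightarrow> a \<in> S \<Longrightarrow> m \<in> carrier M \<Longrightarrow>
      w (i, a \<odot>\<^bsub>RM\<^esub> m) = (\<Sum>j\<le>i. hyperderiv j a * w (i - j, m))"
    and "f \<in> N"
  shows "pairing w f = 0"
proof -
  define H where "H = {f \<in> carrier F. pairing w f = 0}"
  have fin: "finite {x. g x \<noteq> 0}" if "g \<in> carrier F" for g
    by (rule F_finite_support[OF that])
  have padd: "pairing w (g + h) = pairing w g + pairing w h"
    if "g \<in> carrier F" "h \<in> carrier F" for g h
    using that by (intro pairing_add fin)
  have psmult: "pairing w (\<lambda>x. a * g x) = a * pairing w g" if "g \<in> carrier F" for a g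
    using that by (intro pairing_smult fin)
  have pdiff: "pairing w (g - h) = pairing w g - pairing w h"
    if "g \<in> carrier F" "h \<in> carrier F" for g h
    using padd[OF F_diff[OF that] that(2)] by simp
  have psum: "pairing w (sum g A) = (\<Sum>x\<in>A. pairing w (g x))"
    if "g \<in> A \<rightarrow> carrier F" for g :: "nat \<Rightarrow> _" and A
    using that
  proof (induction A rule: infinite_finite_induct)
    case (insert x A)
    then have "g x \<in> carrier F" "sum g A \<in> carrier F" "g \<in> A \<rightarrow> carrier F"
      using F_sum[of g A] by simp_all
    then show ?case by (simp only: sum.insert[OF insert(1,2)] padd insert(3))
  qed simp_all
  have "submodule H (ring_on S) F"
  proof (rule F.submoduleI)
    fix f assume f: "f \<in> H"
    then have "\<ominus>\<^bsub>F\<^esub> f = 0 - f"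
      using F_minus[of f 0] F.M.l_zero[of "\<ominus>\<^bsub>F\<^esub> f"] unfolding H_def
      by (simp add: a_minus_def)
    then show "\<ominus>\<^bsub>F\<^esub> f \<in> H"
      using f pdiff[OF F_closed(3), of f] F_diff[OF F_closed(3), of f] by (simp add: H_def)
  qed (use F_closed padd psmult in \<open>auto simp: H_def \<close>)
  moreover have "D_symbol i (m1 \<oplus>\<^bsub>M\<^esub> m2) - (D_symbol i m1 + D_symbol i m2) \<in> H"
    if "i \<le> k" "m1 \<in> carrier M" "m2 \<in> carrier M" for i m1 m2
  proof -
    have m: "m1 \<oplus>\<^bsub>M\<^esub> m2 \<in> carrier M" using RM.M.a_closed[of m1 m2] that by simp
    note D = D_symbol_closed[OF that(1)]
    show ?thesis
      using that m D F_diff[OF D[OF m] F_closed(1)[OF D[OF that(2)] D[OF that(3)]]]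
      by (simp add: H_def pdiff padd F_closed(1) pairing_D_symbol additive)
  qed
  moreover have "D_symbol i (a \<odot>\<^bsub>RM\<^esub> m) - leibniz_sum i a m \<in> H"
    if i: "i \<le> k" and a: "a \<in> S" and m: "m \<in> carrier M" for i a m
  proof -
    have am: "a \<odot>\<^bsub>RM\<^esub> m \<in> carrier M" using RM.smult_closed[of a m] a m by simp
    have "pairing w (leibniz_sum i a m) =
        (\<Sum>j\<le>i. pairing w (\<lambda>x. hyperderiv j a * D_symbol (i - j) m x))"
      using i m Kbar_t_hyperderiv[OF a]
      by (intro psum funcsetI smult_D_symbol_closed) auto
    also have "\<dots> = (\<Sum>j\<le>i. hyperderiv j a * w (i - j, m))"
      using i m by (intro sum.cong refl) (simp add: psmult D_symbol_closed pairing_D_symbol)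
    finally have "pairing w (leibniz_sum i a m) = (\<Sum>j\<le>i. hyperderiv j a * w (i - j, m))" .
    then have "pairing w (D_symbol i (a \<odot>\<^bsub>RM\<^esub> m) - leibniz_sum i a m) = 0"
      unfolding pdiff[OF D_symbol_closed[OF i am] leibniz_sum_closed[OF i a m]]
      by (simp only: pairing_D_symbol leibniz[OF i a m] diff_self)
    then show ?thesis
      using F_diff[OF D_symbol_closed[OF i am] leibniz_sum_closed[OF i a m]] by (simp only: H_def mem_Collect_eq)
  qed
  ultimately have "N \<subseteq> H" by (rule kernel_minimal)
  then show ?thesis using assms(3) by (auto simp only: H_def)
qed

lemma symbols_sigma_eq:
  assumes "f \<in> carrier F"
  shows "symbols_sigma q K k M f =
    (\<Sum>x | f x \<noteq> 0. (\<lambda>y. twist q (f x) * D_symbol (fst x) (sigma M (snd x)) y))"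
proof -
  have "(\<lambda>x. twist q (f x) \<odot>\<^bsub>F\<^esub> D_symbol (fst x) (sigma M (snd x))) \<in> {x. f x \<noteq> 0} \<rightarrow> carrier F"
    using F_support[OF assms] F_coeff[OF assms] unfolding F_simps(3)
    by (intro funcsetI smult_D_symbol_closed twist_closed sigma_closed) auto
  then show ?thesis
    unfolding symbols_sigma_def by (simp add: F_finsum)
qed

lemma symbols_sigma_closed:
  assumes "f \<in> carrier F"
  shows "symbols_sigma q K k M f \<in> carrier F"
  unfolding symbols_sigma_eq[OF assms]
  using F_support[OF assms] F_coeff[OF assms]
  by (intro F_sum funcsetI smult_D_symbol_closed twist_closed sigma_closed) auto

lemma symbols_sigma_add:
  assumes "f \<in> carrier F" "g \<in> carrier F"
  shows "symbols_sigma q K k M (f + g) = symbols_sigma q K k M f + symbols_sigma q K k M g"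
  unfolding symbols_sigma_eq[OF assms(1)] symbols_sigma_eq[OF assms(2)]
    symbols_sigma_eq[OF F_closed(1)[OF assms]]
  by (rule support_sum_add[OF F_finite_support[OF assms(1)] F_finite_support[OF assms(2)]])
    (auto simp: fun_eq_iff twist_add distrib_right)

lemma symbols_sigma_smult:
  assumes a: "a \<in> S" and f: "f \<in> carrier F"
  shows "symbols_sigma q K k M (\<lambda>x. a * f x) = (\<lambda>x. twist q a * symbols_sigma q K k M f x)"
proof -
  have "symbols_sigma q K k M (\<lambda>x. a * f x) =
      (\<Sum>x | f x \<noteq> 0. (\<lambda>y. twist q (a * f x) * D_symbol (fst x) (sigma M (snd x)) y))"
    unfolding symbols_sigma_eq[OF F_closed(2)[OF a f]]
    by (rule support_sum_superset[where \<phi> = "\<lambda>x b y. twist q b * D_symbol (fst x) (sigma M (snd x)) y"])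
      (use F_finite_support[OF f] in \<open>auto simp: fun_eq_iff\<close>)
  also have "\<dots> = (\<Sum>x | f x \<noteq> 0. (\<lambda>y. twist q a * (twist q (f x) * D_symbol (fst x) (sigma M (snd x)) y)))"
    using twist_mult[OF S_power_series[OF a] S_power_series[OF F_coeff[OF f]]]
    by (simp add: mult.assoc)
  also have "\<dots> = (\<lambda>x. twist q a * symbols_sigma q K k M f x)"
    unfolding symbols_sigma_eq[OF f] by (simp add: fun_eq_iff sum_fun_apply sum_distrib_left)
  finally show ?thesis .
qed

lemma symbols_sigma_D_symbol:
  assumes "i \<le> k" "m \<in> carrier M"
  shows "symbols_sigma q K k M (D_symbol i m) = D_symbol i (sigma M m)"
  unfolding symbols_sigma_eq[OF D_symbol_closed[OF assms]] D_symbol_support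
  by (simp add: D_symbol_def)

lemma symbols_sigma_zero: "symbols_sigma q K k M 0 = 0"
  by (simp add: symbols_sigma_eq[OF F_closed(3)])

lemma symbols_sigma_diff:
  assumes "f \<in> carrier F" "g \<in> carrier F"
  shows "symbols_sigma q K k M (f - g) = symbols_sigma q K k M f - symbols_sigma q K k M g"
  using symbols_sigma_add[OF F_diff[OF assms] assms(2)] by (simp add: algebra_simps)

lemma symbols_sigma_sum:
  assumes "g \<in> A \<rightarrow> carrier F"
  shows "symbols_sigma q K k M (sum g A) = (\<Sum>x\<in>A. symbols_sigma q K k M (g x))"
  using assms
proof (induction A rule: infinite_finite_induct)
  case (insert x A)
  then have "g x \<in> carrier F" "sum g A \<in> carrier F" "g \<in> A \<rightarrow> carrier F"
    using F_sum[of g A] by simp_all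
  then show ?case by (simp only: sum.insert[OF insert(1,2)] symbols_sigma_add insert(3))
qed (simp_all add: symbols_sigma_zero)

text \<open>Twisting commutes with the hyperderivatives, so \<open>\<sigma>\<close> carries the product relator of \<open>a\<close> and \<open>m\<close> to
  that of \<open>a\<^sup>\<sigma>\<close> and \<open>\<sigma> m\<close>.\<close>

lemma symbols_sigma_kernel:
  assumes "f \<in> N"
  shows "symbols_sigma q K k M f \<in> N"
proof -
  define H where "H = {f \<in> carrier F. symbols_sigma q K k M f \<in> N}"
  have "submodule H (ring_on S) F"
  proof (rule F.submoduleI)
    fix f assume f: "f \<in> H"
    then have "\<ominus>\<^bsub>F\<^esub> f = 0 - f"
      using F_minus[of f 0] F.M.l_zero[of "\<ominus>\<^bsub>F\<^esub> f"] unfolding H_def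
      by (simp add: a_minus_def)
    then show "\<ominus>\<^bsub>F\<^esub> f \<in> H"
      using f symbols_sigma_diff[OF F_closed(3), of f] F_diff[OF F_closed(3), of f] kernel_closed(4)
      by (simp add: H_def symbols_sigma_zero)
  qed (use F_closed symbols_sigma_add symbols_sigma_smult symbols_sigma_zero kernel_closed twist_closed in
      \<open>auto simp: H_def \<close>)
  moreover have "D_symbol i (m1 \<oplus>\<^bsub>M\<^esub> m2) - (D_symbol i m1 + D_symbol i m2) \<in> H"
    if "i \<le> k" "m1 \<in> carrier M" "m2 \<in> carrier M" for i m1 m2
  proof -
    have m: "m1 \<oplus>\<^bsub>M\<^esub> m2 \<in> carrier M" using RM.M.a_closed[of m1 m2] that by simp
    note D = D_symbol_closed[OF that(1)]
    note sD = symbols_sigma_D_symbol[OF that(1)]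
    have "symbols_sigma q K k M (D_symbol i (m1 \<oplus>\<^bsub>M\<^esub> m2) - (D_symbol i m1 + D_symbol i m2)) =
        D_symbol i (sigma M m1 \<oplus>\<^bsub>M\<^esub> sigma M m2) - (D_symbol i (sigma M m1) + D_symbol i (sigma M m2))"
      unfolding symbols_sigma_diff[OF D[OF m] F_closed(1)[OF D[OF that(2)] D[OF that(3)]]]
        symbols_sigma_add[OF D[OF that(2)] D[OF that(3)]] sD[OF m] sD[OF that(2)] sD[OF that(3)]
        sigma_add[OF that(2,3)] ..
    also have "\<dots> \<in> N"
      using that by (intro relators_in_kernel(1) sigma_closed)
    finally show ?thesis
      using F_diff[OF D[OF m] F_closed(1)[OF D[OF that(2)] D[OF that(3)]]]
      by (simp only: H_def mem_Collect_eq)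
  qed
  moreover have "D_symbol i (a \<odot>\<^bsub>RM\<^esub> m) - leibniz_sum i a m \<in> H"
    if i: "i \<le> k" and a: "a \<in> S" and m: "m \<in> carrier M" for i a m
  proof -
    have am: "a \<odot>\<^bsub>RM\<^esub> m \<in> carrier M" using RM.smult_closed[of a m] a m by simp
    have "symbols_sigma q K k M (leibniz_sum i a m) =
        (\<Sum>j\<le>i. symbols_sigma q K k M (\<lambda>x. hyperderiv j a * D_symbol (i - j) m x))"
      using i m Kbar_t_hyperderiv[OF a]
      by (intro symbols_sigma_sum funcsetI smult_D_symbol_closed) auto
    also have "\<dots> = leibniz_sum i (twist q a) (sigma M m)"
    proof (rule sum.cong[OF refl])
      fix j assume "j \<in> {..i}"
      have "i - j \<le> k" using i by simp
      then show "symbols_sigma q K k M (\<lambda>x. hyperderiv j a * D_symbol (i - j) m x) =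
          (\<lambda>x. hyperderiv j (twist q a) * D_symbol (i - j) (sigma M m) x)"
        by (simp only: symbols_sigma_smult[OF Kbar_t_hyperderiv[OF a] D_symbol_closed[OF _ m]]
            symbols_sigma_D_symbol[OF _ m] twist_hyperderiv[OF S_power_series[OF a]])
    qed
    finally have "symbols_sigma q K k M (D_symbol i (a \<odot>\<^bsub>RM\<^esub> m) - leibniz_sum i a m) =
        D_symbol i (twist q a \<odot>\<^bsub>RM\<^esub> sigma M m) - leibniz_sum i (twist q a) (sigma M m)"
      by (simp only: symbols_sigma_diff[OF D_symbol_closed[OF i am] leibniz_sum_closed[OF i a m]]
          symbols_sigma_D_symbol[OF i am] sigma_smult[OF a m])
    also have "\<dots> \<in> N"
      by (intro relators_in_kernel(2) i sigma_closed m twist_closed a)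
    finally show ?thesis
      using F_diff[OF D_symbol_closed[OF i am] leibniz_sum_closed[OF i a m]]
      by (simp only: H_def mem_Collect_eq)
  qed
  ultimately have "N \<subseteq> H" by (rule kernel_minimal)
  then show ?thesis using assms by (auto simp only: H_def)
qed

lemma prolongation_sigma_coset:
  assumes "f \<in> carrier F"
  shows "prolongation_sigma q K k M (N +>\<^bsub>F\<^esub> f) = N +>\<^bsub>F\<^esub> symbols_sigma q K k M f"
  unfolding prolongation_sigma_def
proof (rule Q.coset_UN_eq[OF assms symbols_sigma_closed])
  fix g assume g: "g \<in> carrier F" "g \<ominus>\<^bsub>F\<^esub> f \<in> N"
  then have "g - f \<in> N" using F_minus[OF assms, of g] by simp
  then have "symbols_sigma q K k M g - symbols_sigma q K k M f \<in> N"
    using symbols_sigma_kernel[of "g - f"] symbols_sigma_diff[OF g(1) assms] by simp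
  then show "symbols_sigma q K k M g \<ominus>\<^bsub>F\<^esub> symbols_sigma q K k M f \<in> N"
    using F_minus[OF symbols_sigma_closed[OF assms]] by simp
qed

end

section \<open>The basis of the prolongation\<close>

locale prolonged_module_basis = prolonged_module q Fq \<theta> K absv M k
  for q :: nat and Fq :: "'c::field set" and \<theta> :: 'c and K :: "'c set" and absv :: "'c \<Rightarrow> real"
    and M :: "('c fls poly, 'm) module" and k :: nat +
  fixes r :: nat and e :: "nat \<Rightarrow> 'm"
  assumes basis: "Kbar_t_basis K M r e"
begin

abbreviation R :: nat where "R \<equiv> r * (k + 1)"

definition comb :: "(nat \<Rightarrow> 'c fls) \<Rightarrow> 'm" where
  "comb c = (\<Oplus>\<^bsub>RM\<^esub>h\<in>{..<r}. c h \<odot>\<^bsub>RM\<^esub> e h)"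

definition coord :: "'m \<Rightarrow> nat \<Rightarrow> 'c fls" where
  "coord m = (SOME c. c \<in> {..<r} \<rightarrow> S \<and> m = comb c)"

definition De :: "nat \<Rightarrow> nat \<times> 'm \<Rightarrow> 'c fls" where
  "De n = D_symbol (n div r) (e (n mod r))"

text \<open>The coordinates of \<open>D\<^sub>i(\<Sum>\<^sub>h c\<^sub>h e\<^sub>h)\<close> with respect to the tuple of the \<open>D\<^sub>l e\<^sub>h\<close>, in block order.\<close>

definition hyper_coords :: "nat \<Rightarrow> (nat \<Rightarrow> 'c fls) \<Rightarrow> nat \<Rightarrow> 'c fls" where
  "hyper_coords i c n = (if n div r \<le> i then hyperderiv (i - n div r) (c (n mod r)) else 0)"

lemma basis_RM: "is_basis (ring_on S) RM {..<r} e"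
  using basis by (simp add: Kbar_t_basis_def)

lemma e_closed: "h < r \<Longrightarrow> e h \<in> carrier M"
  using basis_RM by (auto simp: is_basis_def generates_def)

lemma smult_e_closed: "a \<in> S \<Longrightarrow> h < r \<Longrightarrow> a \<odot>\<^bsub>RM\<^esub> e h \<in> carrier RM"
  by (rule RM.smult_closed) (simp_all add: e_closed)

lemma comb_closed: "c \<in> {..<r} \<rightarrow> S \<Longrightarrow> comb c \<in> carrier M"
  unfolding comb_def restrict_scalars_simps(1)[symmetric]
  by (intro RM.finsum_closed funcsetI smult_e_closed) auto

lemma coord_spec:
  assumes "m \<in> carrier M"
  shows "coord m \<in> {..<r} \<rightarrow> S" "comb (coord m) = m"
proof -
  have "\<exists>c. c \<in> {..<r} \<rightarrow> S \<and> m = comb c"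
    using RM.basis_coords_exist[OF basis_RM, of m] assms unfolding comb_def by auto
  then have "coord m \<in> {..<r} \<rightarrow> S \<and> m = comb (coord m)"
    unfolding coord_def by (rule someI_ex)
  then show "coord m \<in> {..<r} \<rightarrow> S" "comb (coord m) = m" by simp_all
qed

lemma coord_comb:
  assumes "c \<in> {..<r} \<rightarrow> S" "h < r"
  shows "coord (comb c) h = c h"
  using RM.basis_coords_unique[OF basis_RM, of "coord (comb c)" c h]
    coord_spec[OF comb_closed[OF assms(1)]] assms by (simp add: comb_def)

lemma coord_add:
  assumes m: "m1 \<in> carrier M" "m2 \<in> carrier M" and h: "h < r"
  shows "coord (m1 \<oplus>\<^bsub>M\<^esub> m2) h = coord m1 h + coord m2 h"
proof -
  let ?c = "\<lambda>h. coord m1 h + coord m2 h"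
  have c: "?c \<in> {..<r} \<rightarrow> S"
    using coord_spec(1)[OF m(1)] coord_spec(1)[OF m(2)] S_closed(3) by (auto simp: Pi_iff)
  have "comb ?c = (\<Oplus>\<^bsub>RM\<^esub>h\<in>{..<r}. coord m1 h \<odot>\<^bsub>RM\<^esub> e h \<oplus>\<^bsub>RM\<^esub> coord m2 h \<odot>\<^bsub>RM\<^esub> e h)"
    unfolding comb_def
  proof (rule RM.finsum_cong')
    fix h assume "h \<in> {..<r}"
    then show "?c h \<odot>\<^bsub>RM\<^esub> e h = coord m1 h \<odot>\<^bsub>RM\<^esub> e h \<oplus>\<^bsub>RM\<^esub> coord m2 h \<odot>\<^bsub>RM\<^esub> e h"
      using RM.smult_l_distr[of "coord m1 h" "coord m2 h" "e h"] e_closed[of h]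
        coord_spec(1)[OF m(1)] coord_spec(1)[OF m(2)] by auto
  next
    show "(\<lambda>h. coord m1 h \<odot>\<^bsub>RM\<^esub> e h \<oplus>\<^bsub>RM\<^esub> coord m2 h \<odot>\<^bsub>RM\<^esub> e h) \<in> {..<r} \<rightarrow> carrier RM"
      using coord_spec(1)[OF m(1)] coord_spec(1)[OF m(2)]
      by (intro funcsetI RM.M.a_closed smult_e_closed) auto
  qed simp
  also have "\<dots> = comb (coord m1) \<oplus>\<^bsub>RM\<^esub> comb (coord m2)"
    unfolding comb_def using coord_spec(1)[OF m(1)] coord_spec(1)[OF m(2)]
    by (intro RM.M.finsum_addf funcsetI smult_e_closed) auto
  also have "\<dots> = m1 \<oplus>\<^bsub>M\<^esub> m2" by (simp add: coord_spec(2) m)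
  finally show ?thesis using coord_comb[OF c h] by simp
qed

lemma coord_smult:
  assumes a: "a \<in> S" and m: "m \<in> carrier M" and h: "h < r"
  shows "coord (a \<odot>\<^bsub>RM\<^esub> m) h = a * coord m h"
proof -
  let ?c = "\<lambda>h. a * coord m h"
  have c: "?c \<in> {..<r} \<rightarrow> S"
    using coord_spec(1)[OF m] a S_closed(4) by (auto simp: Pi_iff)
  have "comb ?c = (\<Oplus>\<^bsub>RM\<^esub>h\<in>{..<r}. a \<odot>\<^bsub>RM\<^esub> (coord m h \<odot>\<^bsub>RM\<^esub> e h))"
    unfolding comb_def
  proof (rule RM.finsum_cong')
    fix h assume "h \<in> {..<r}"
    then show "?c h \<odot>\<^bsub>RM\<^esub> e h = a \<odot>\<^bsub>RM\<^esub> (coord m h \<odot>\<^bsub>RM\<^esub> e h)"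
      using RM.smult_assoc1[of a "coord m h" "e h"] e_closed[of h] coord_spec(1)[OF m] a by auto
  next
    show "(\<lambda>h. a \<odot>\<^bsub>RM\<^esub> (coord m h \<odot>\<^bsub>RM\<^esub> e h)) \<in> {..<r} \<rightarrow> carrier RM"
      using coord_spec(1)[OF m] a
      by (intro funcsetI RM.smult_closed[OF _ smult_e_closed]) auto
  qed simp
  also have "\<dots> = a \<odot>\<^bsub>RM\<^esub> comb (coord m)"
    unfolding comb_def using coord_spec(1)[OF m] a
    by (intro RM.finsum_smult_ldistr[symmetric] funcsetI smult_e_closed) auto
  also have "\<dots> = a \<odot>\<^bsub>RM\<^esub> m" by (simp only: coord_spec(2)[OF m])
  finally show ?thesis using coord_comb[OF c h] by simp
qed

lemma coord_e:
  assumes "g < r" "h < r"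
  shows "coord (e g) h = (if g = h then 1 else 0)"
proof -
  let ?c = "\<lambda>h. if h = g then 1 else 0 :: 'c fls"
  have c: "?c \<in> {..<r} \<rightarrow> S" using S_closed(1,2) by auto
  have "comb ?c = (\<Oplus>\<^bsub>RM\<^esub>h\<in>{..<r}. if h = g then e h else \<zero>\<^bsub>RM\<^esub>)"
    unfolding comb_def
  proof (rule RM.finsum_cong')
    fix h assume "h \<in> {..<r}"
    then have "e h \<in> carrier RM" using e_closed by simp
    then show "?c h \<odot>\<^bsub>RM\<^esub> e h = (if h = g then e h else \<zero>\<^bsub>RM\<^esub>)"
      using RM.smult_one[of "e h"] RM.smult_l_null[of "e h"] by auto
  qed (use e_closed RM.M.zero_closed in auto)
  also have "\<dots> = e g"
    using RM.M.add.finprod_singleton_swap[of g "{..<r}" e] assms e_closed by auto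
  finally show ?thesis using coord_comb[OF c assms(2)] by auto
qed

lemma De_closed:
  assumes "n < R"
  shows "De n \<in> carrier F"
  unfolding De_def using block_index_less[OF assms] by (intro D_symbol_closed e_closed)

lemma smult_De_closed: "a \<in> S \<Longrightarrow> n < R \<Longrightarrow> (\<lambda>x. a * De n x) \<in> carrier F"
  by (rule F_closed(2)[OF _ De_closed])

lemma hyper_coords_closed:
  assumes "c \<in> {..<r} \<rightarrow> S"
  shows "hyper_coords i c \<in> {..<R} \<rightarrow> S"
proof
  fix n assume "n \<in> {..<R}"
  then have "c (n mod r) \<in> S" using block_index_less(1)[of n r k] assms by auto
  then show "hyper_coords i c n \<in> S"
    using S_closed(1) Kbar_t_hyperderiv by (simp add: hyper_coords_def)
qed

text \<open>The additivity relator at \<open>0 + 0\<close> is \<open>- D\<^sub>i 0\<close>.\<close>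

lemma D_zero_in_kernel:
  assumes "i \<le> k"
  shows "D_symbol i \<zero>\<^bsub>M\<^esub> \<in> N"
proof -
  have z: "\<zero>\<^bsub>M\<^esub> \<in> carrier M" using RM.M.zero_closed by simp
  then have "\<zero>\<^bsub>M\<^esub> \<oplus>\<^bsub>M\<^esub> \<zero>\<^bsub>M\<^esub> = \<zero>\<^bsub>M\<^esub>" using RM.M.l_zero[of "\<zero>\<^bsub>M\<^esub>"] by simp
  then have "- D_symbol i \<zero>\<^bsub>M\<^esub> \<in> N"
    using relators_in_kernel(1)[OF assms z z] by simp
  then show ?thesis using kernel_closed(4)[of "- D_symbol i \<zero>\<^bsub>M\<^esub>"] by simp
qed

text \<open>Additivity splits \<open>D\<^sub>i\<close> of a linear combination into the \<open>D\<^sub>i(c\<^sub>h e\<^sub>h)\<close>, and the product rule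
  expands each of these.\<close>

lemma D_finsum_expand:
  assumes i: "i \<le> k" and "A \<subseteq> {..<r}" and c: "c \<in> {..<r} \<rightarrow> S"
  shows "D_symbol i (\<Oplus>\<^bsub>RM\<^esub>h\<in>A. c h \<odot>\<^bsub>RM\<^esub> e h) - (\<Sum>h\<in>A. leibniz_sum i (c h) (e h)) \<in> N"
proof -
  have "finite A" using assms(2) finite_subset by blast
  then show ?thesis using assms(2)
  proof (induction A)
    case empty
    then show ?case using D_zero_in_kernel[OF i] by simp
  next
    case (insert h A)
    let ?x = "c h \<odot>\<^bsub>RM\<^esub> e h" and ?y = "\<Oplus>\<^bsub>RM\<^esub>h\<in>A. c h \<odot>\<^bsub>RM\<^esub> e h"
    have h: "h < r" and A: "A \<subseteq> {..<r}" and ch: "c h \<in> S" using insert(4) c by auto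
    have x: "?x \<in> carrier RM" by (rule smult_e_closed[OF ch h])
    have terms: "(\<lambda>h. c h \<odot>\<^bsub>RM\<^esub> e h) \<in> A \<rightarrow> carrier RM"
      using A c by (intro funcsetI smult_e_closed) auto
    then have y: "?y \<in> carrier RM" by (rule RM.M.finsum_closed)
    have "(\<Oplus>\<^bsub>RM\<^esub>h\<in>insert h A. c h \<odot>\<^bsub>RM\<^esub> e h) = ?x \<oplus>\<^bsub>M\<^esub> ?y"
      using RM.M.finsum_insert[OF insert(1,2) terms x] by simp
    then have "D_symbol i (\<Oplus>\<^bsub>RM\<^esub>h\<in>insert h A. c h \<odot>\<^bsub>RM\<^esub> e h) -
        (\<Sum>h\<in>insert h A. leibniz_sum i (c h) (e h)) =
      (D_symbol i (?x \<oplus>\<^bsub>M\<^esub> ?y) - (D_symbol i ?x + D_symbol i ?y)) +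
      ((D_symbol i ?x - leibniz_sum i (c h) (e h)) +
       (D_symbol i ?y - (\<Sum>h\<in>A. leibniz_sum i (c h) (e h))))"
      by (simp only: sum.insert[OF insert(1,2)]) (simp only: algebra_simps)
    also have "\<dots> \<in> N"
      using x y by (intro kernel_closed(2) relators_in_kernel i ch e_closed h insert(3) A) simp_all
    finally show ?case .
  qed
qed

text \<open>Collecting the terms of the product rule by the index \<open>l = i - j\<close> of the symbol \<open>D\<^sub>l e\<^sub>h\<close> gives the
  block order of the tuple.\<close>

lemma leibniz_sums_eq_blocks:
  assumes "i \<le> k"
  shows "(\<Sum>h<r. leibniz_sum i (c h) (e h)) = (\<Sum>n<R. (\<lambda>x. hyper_coords i c n * De n x))"
proof -
  define g where "g l h = (\<lambda>x. (if l \<le> i then hyperderiv (i - l) (c h) else 0) * D_symbol l (e h) x)"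
    for l h
  have "(\<Sum>n<R. (\<lambda>x. hyper_coords i c n * De n x)) = (\<Sum>n<R. g (n div r) (n mod r))"
    by (simp only: g_def hyper_coords_def De_def)
  also have "\<dots> = (\<Sum>l\<le>k. \<Sum>h<r. g l h)" by (rule sum_blocks)
  also have "\<dots> = (\<Sum>h<r. \<Sum>l\<le>k. g l h)" by (rule sum.swap)
  also have "\<dots> = (\<Sum>h<r. leibniz_sum i (c h) (e h))"
  proof (rule sum.cong[OF refl])
    fix h
    have "(\<Sum>l\<le>k. g l h) = (\<Sum>l\<le>i. g l h)"
      using assms by (intro sum.mono_neutral_right) (auto simp: g_def fun_eq_iff)
    also have "\<dots> = leibniz_sum i (c h) (e h)"
      by (rule sum.reindex_bij_witness[of _ "\<lambda>j. i - j" "\<lambda>l. i - l"]) (auto simp: g_def)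
    finally show "(\<Sum>l\<le>k. g l h) = leibniz_sum i (c h) (e h)" .
  qed
  finally show ?thesis ..
qed

lemma D_comb_expand:
  assumes "i \<le> k" "c \<in> {..<r} \<rightarrow> S"
  shows "D_symbol i (comb c) - (\<Sum>n<R. (\<lambda>x. hyper_coords i c n * De n x)) \<in> N"
  using D_finsum_expand[OF assms(1) order_refl assms(2)]
  unfolding comb_def leibniz_sums_eq_blocks[OF assms(1)] .

text \<open>The symbols \<open>D\<^sub>i m\<close> generate, and each of them is a combination of the \<open>D\<^sub>l e\<^sub>h\<close> modulo the
  kernel.\<close>

lemma De_generate:
  assumes f: "f \<in> carrier F"
  obtains c where "c \<in> {..<R} \<rightarrow> S" "f - (\<Sum>n<R. (\<lambda>x. c n * De n x)) \<in> N"
proof -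
  define a where "a x = hyper_coords (fst x) (coord (snd x))" for x
  define c where "c n = (\<Sum>x | f x \<noteq> 0. f x * a x n)" for n
  have a: "a x \<in> {..<R} \<rightarrow> S" "D_symbol (fst x) (snd x) - (\<Sum>n<R. (\<lambda>y. a x n * De n y)) \<in> N"
    if "f x \<noteq> 0" for x
    using F_support[OF f that] hyper_coords_closed[OF coord_spec(1)] D_comb_expand[OF _ coord_spec(1)]
    by (auto simp: a_def coord_spec(2))
  have "c \<in> {..<R} \<rightarrow> S"
    unfolding c_def by (intro funcsetI S_sum S_closed(4) F_coeff[OF f] funcset_mem[OF a(1)]) auto
  moreover have "f - (\<Sum>n<R. (\<lambda>x. c n * De n x)) =
      (\<Sum>x | f x \<noteq> 0. (\<lambda>y. f x * (D_symbol (fst x) (snd x) - (\<Sum>n<R. (\<lambda>y. a x n * De n y))) y))"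
  proof
    fix y
    have "f y = (\<Sum>x | f x \<noteq> 0. f x * D_symbol (fst x) (snd x) y)"
      using arg_cong[OF F_expand[OF f], of "\<lambda>g. g y"] by (simp add: sum_fun_apply)
    moreover have "(\<Sum>n<R. c n * De n y) = (\<Sum>x | f x \<noteq> 0. f x * (\<Sum>n<R. a x n * De n y))"
      unfolding c_def sum_distrib_right sum_distrib_left
      by (subst sum.swap) (simp add: mult.assoc)
    ultimately show "(f - (\<Sum>n<R. (\<lambda>x. c n * De n x))) y =
      (\<Sum>x | f x \<noteq> 0. (\<lambda>y. f x * (D_symbol (fst x) (snd x) - (\<Sum>n<R. (\<lambda>y. a x n * De n y))) y)) y"
      by (simp add: sum_fun_apply sum_subtractf right_diff_distrib)
  qed
  moreover have "\<dots> \<in> N"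
    by (rule kernel_sum, rule kernel_closed(3)[OF F_coeff[OF f] a(2)]) simp
  ultimately show ?thesis using that[of c] by simp
qed

text \<open>The value on \<open>D\<^sub>i m\<close> of the coordinate function that is dual to \<open>D\<^sub>j e\<^sub>h\<close>.\<close>

definition coord_weight :: "nat \<Rightarrow> nat \<Rightarrow> nat \<times> 'm \<Rightarrow> 'c fls" where
  "coord_weight j h x = (if j \<le> fst x then hyperderiv (fst x - j) (coord (snd x) h) else 0)"

text \<open>The coordinate \<open>m \<mapsto> coord m h\<close> is linear, so the Leibniz rule in \<open>Kbar[t]\<close> is exactly the
  compatibility with the product relators.\<close>

lemma coord_weight_kernel:
  assumes h: "h < r" and "f \<in> N"
  shows "pairing (coord_weight j h) f = 0"
proof (rule pairing_kernel[OF _ _ assms(2)])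
  fix i m1 m2 assume "m1 \<in> carrier M" "m2 \<in> carrier M"
  then show "coord_weight j h (i, m1 \<oplus>\<^bsub>M\<^esub> m2) = coord_weight j h (i, m1) + coord_weight j h (i, m2)"
    by (simp add: coord_weight_def coord_add h hyperderiv_add)
next
  fix i a m assume a: "a \<in> S" and m: "m \<in> carrier M"
  have c: "coord m h \<in> S" using coord_spec(1)[OF m] h by auto
  show "coord_weight j h (i, a \<odot>\<^bsub>RM\<^esub> m) = (\<Sum>l\<le>i. hyperderiv l a * coord_weight j h (i - l, m))"
  proof (cases "j \<le> i")
    case True
    have "(\<Sum>l\<le>i. hyperderiv l a * coord_weight j h (i - l, m)) =
        (\<Sum>l\<le>i - j. hyperderiv l a * coord_weight j h (i - l, m))"
      using True by (intro sum.mono_neutral_right) (auto simp: coord_weight_def)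
    also have "\<dots> = (\<Sum>l\<le>i - j. hyperderiv l a * hyperderiv (i - j - l) (coord m h))"
      using True by (intro sum.cong refl) (auto simp: coord_weight_def add.commute)
    also have "\<dots> = hyperderiv (i - j) (coord (a \<odot>\<^bsub>RM\<^esub> m) h)"
      unfolding coord_smult[OF a m h] hyperderiv_mult[OF S_power_series[OF a] S_power_series[OF c]] ..
    finally show ?thesis using True by (simp add: coord_weight_def)
  next
    case False
    then have "coord_weight j h (i - l, n) = 0" for l n
      by (simp add: coord_weight_def)
    from this[of 0] this show ?thesis by simp
  qed
qed

lemma coord_weight_e:
  assumes "g < r" "h < r"
  shows "coord_weight j h (l, e g) = (if l = j \<and> g = h then 1 else 0)"
  using coord_e[OF assms] by (auto simp: coord_weight_def hyperderiv_1)

text \<open>The functional with weight \<open>coord_weight\<close> at the position \<open>n\<^sub>0\<close> takes the value \<open>1\<close> on the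
  \<open>n\<^sub>0\<close>-th entry of the tuple and \<open>0\<close> on all others, so it reads off the coefficient \<open>c n\<^sub>0\<close>.\<close>

lemma De_independent:
  assumes T: "finite T" "T \<subseteq> {..<R}" and c: "c \<in> T \<rightarrow> S"
    and N: "(\<Sum>n\<in>T. (\<lambda>x. c n * De n x)) \<in> N" and n0: "n0 \<in> T"
  shows "c n0 = 0"
proof -
  let ?w = "coord_weight (n0 div r) (n0 mod r)"
  have lt: "n mod r < r" if "n \<in> T" for n using block_index_less(1)[of n r k] T(2) that by auto
  have De: "pairing ?w (\<lambda>x. c n * De n x) = (if n = n0 then c n else 0)" if "n \<in> T" for n
  proof -
    have "pairing ?w (\<lambda>x. c n * De n x) = c n * ?w (n div r, e (n mod r))"
      using De_closed[of n] T(2) that F_finite_support[of "De n"]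
      by (subst pairing_smult) (auto simp: De_def pairing_D_symbol)
    also have "\<dots> = (if n = n0 then c n else 0)"
      unfolding coord_weight_e[OF lt[OF that] lt[OF n0]] by (auto; metis div_mult_mod_eq)
    finally show ?thesis .
  qed
  have "pairing ?w (\<Sum>n\<in>U. (\<lambda>x. c n * De n x)) = (\<Sum>n\<in>U. if n = n0 then c n else 0)"
    if "U \<subseteq> T" for U
    using finite_subset[OF that T(1)] that
  proof (induction U)
    case (insert n U)
    have n: "(\<lambda>x. c n * De n x) \<in> carrier F" and U: "(\<Sum>n\<in>U. (\<lambda>x. c n * De n x)) \<in> carrier F"
      using insert(4) T(2) c by (auto intro!: smult_De_closed F_sum)
    show ?case
      unfolding sum.insert[OF insert(1,2)]
        pairing_add[OF F_finite_support[OF n] F_finite_support[OF U]]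
      using insert(3,4) De[of n] by simp
  qed simp
  then have "pairing ?w (\<Sum>n\<in>T. (\<lambda>x. c n * De n x)) = c n0"
    using T(1) n0 by (simp add: sum.delta)
  then show ?thesis
    using coord_weight_kernel[OF lt[OF n0] N] by simp
qed

abbreviation "P \<equiv> prolongation_t_module K k M"
abbreviation "P' \<equiv> prolongation q K k M"

lemma P_eq: "P = quotient_module F N"
  by (simp add: prolongation_t_module_def)

lemma P_carrier: "carrier P = (\<lambda>f. N +>\<^bsub>F\<^esub> f) ` carrier F"
  unfolding P_eq by (rule Q.quotient_module_simps(1))

lemma P_zero: "\<zero>\<^bsub>P\<^esub> = N"
  unfolding P_eq by (rule Q.quotient_module_simps(2))

lemma P_smult: "a \<in> S \<Longrightarrow> f \<in> carrier F \<Longrightarrow> a \<odot>\<^bsub>P\<^esub> (N +>\<^bsub>F\<^esub> f) = N +>\<^bsub>F\<^esub> (\<lambda>x. a * f x)"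
  unfolding P_eq using Q.quotient_module_smult[of a f] by simp

lemma P_finsum:
  assumes "g \<in> A \<rightarrow> carrier F"
  shows "(\<Oplus>\<^bsub>P\<^esub>i\<in>A. N +>\<^bsub>F\<^esub> g i) = N +>\<^bsub>F\<^esub> sum g A"
  unfolding P_eq Q.finsum_quotient_module[OF assms] F_finsum[OF assms] ..

lemma restrict_prolongation_carrier: "carrier (restrict_scalars P') = carrier P"
  by (simp add: restrict_scalars_def prolongation_def Let_def)

lemma restrict_prolongation_zero: "\<zero>\<^bsub>restrict_scalars P'\<^esub> = N"
  by (simp add: restrict_scalars_def prolongation_def Let_def P_zero)

lemma restrict_prolongation_finsum: "finsum (restrict_scalars P') = finsum P"
  by (simp add: fun_eq_iff finsum_def restrict_scalars_def prolongation_def Let_def)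

sublocale PM: abelian_monoid P
  unfolding P_eq by (rule Q.quotient_module_abelian_monoid)

lemma restrict_prolongation_smult:
  assumes "a \<in> S" "f \<in> carrier F"
  shows "a \<odot>\<^bsub>restrict_scalars P'\<^esub> (N +>\<^bsub>F\<^esub> f) = N +>\<^bsub>F\<^esub> (\<lambda>x. a * f x)"
proof -
  define g where "g = (\<lambda>i. Polynomial.coeff [:a:] i \<odot>\<^bsub>P\<^esub> (prolongation_sigma q K k M ^^ i) (N +>\<^bsub>F\<^esub> f))"
  have g0: "g 0 = N +>\<^bsub>F\<^esub> (\<lambda>x. a * f x)"
    using P_smult[OF assms] by (simp add: g_def)
  then have "g 0 \<in> carrier P"
    using F_closed(2)[OF assms] by (auto simp: P_carrier)
  have "a \<odot>\<^bsub>restrict_scalars P'\<^esub> (N +>\<^bsub>F\<^esub> f) = finsum P g {0}"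
    by (simp add: restrict_scalars_def prolongation_def Let_def g_def)
  also have "\<dots> = g 0"
    using PM.finsum_insert[of "{}" 0 g] \<open>g 0 \<in> carrier P\<close> by simp
  finally show ?thesis unfolding g0 .
qed

lemma sigma_prolongation:
  assumes f: "f \<in> carrier F"
  shows "sigma P' (N +>\<^bsub>F\<^esub> f) = N +>\<^bsub>F\<^esub> symbols_sigma q K k M f"
proof -
  let ?\<sigma> = "Polynomial.monom 1 1 :: 'c fls poly"
  define g where "g = (\<lambda>i. Polynomial.coeff ?\<sigma> i \<odot>\<^bsub>P\<^esub> (prolongation_sigma q K k M ^^ i) (N +>\<^bsub>F\<^esub> f))"
  have sf: "symbols_sigma q K k M f \<in> carrier F" by (rule symbols_sigma_closed[OF f])
  \<comment> \<open>The skew polynomial \<open>\<sigma>\<close> has degree 1, so its action also has a term for \<open>i = 0\<close>, with coefficient 0.\<close>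
  have "g 0 = N +>\<^bsub>F\<^esub> 0"
    using P_smult[OF S_closed(1) f] by (simp add: g_def zero_fun_def)
  then have g0: "g 0 = \<zero>\<^bsub>P\<^esub>"
    using Q.coset_eq_kernel_iff[OF F_closed(3)] kernel_closed(1) by (simp add: P_zero)
  have g1: "g 1 = N +>\<^bsub>F\<^esub> symbols_sigma q K k M f"
    using P_smult[OF S_closed(2) sf] prolongation_sigma_coset[OF f] by (simp add: g_def)
  then have g1': "g 1 \<in> carrier P" using sf by (auto simp: P_carrier)
  have "sigma P' (N +>\<^bsub>F\<^esub> f) = finsum P g {..Polynomial.degree ?\<sigma>}"
    by (simp add: sigma_def prolongation_def Let_def g_def)
  also have "{..Polynomial.degree ?\<sigma>} = {1, 0}"
    by (auto simp: degree_monom_eq)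
  also have "finsum P g {1, 0} = g 1 \<oplus>\<^bsub>P\<^esub> (g 0 \<oplus>\<^bsub>P\<^esub> \<zero>\<^bsub>P\<^esub>)"
    using PM.finsum_insert[of "{0}" 1 g] PM.finsum_insert[of "{}" 0 g] g0 g1' by simp
  also have "\<dots> = g 1" using g1' g0 by simp
  finally show ?thesis unfolding g1 .
qed

lemma D_tuple_eq: "D_tuple K k M r e n = N +>\<^bsub>F\<^esub> De n"
  by (simp add: D_tuple_def prolongation_D_def De_def)

lemma D_tuple_combination:
  assumes T: "T \<subseteq> {..<R}" and c: "c \<in> T \<rightarrow> S"
  shows "(\<Oplus>\<^bsub>restrict_scalars P'\<^esub>n\<in>T. c n \<odot>\<^bsub>restrict_scalars P'\<^esub> D_tuple K k M r e n) =
    N +>\<^bsub>F\<^esub> (\<Sum>n\<in>T. (\<lambda>x. c n * De n x))"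
proof -
  have closed: "(\<lambda>n x. c n * De n x) \<in> T \<rightarrow> carrier F"
    using T c by (intro funcsetI smult_De_closed) auto
  have "(\<Oplus>\<^bsub>P\<^esub>n\<in>T. c n \<odot>\<^bsub>restrict_scalars P'\<^esub> D_tuple K k M r e n) =
      (\<Oplus>\<^bsub>P\<^esub>n\<in>T. N +>\<^bsub>F\<^esub> (\<lambda>x. c n * De n x))"
  proof (rule PM.finsum_cong')
    show "(\<lambda>n. N +>\<^bsub>F\<^esub> (\<lambda>x. c n * De n x)) \<in> T \<rightarrow> carrier P"
      using closed by (auto simp: P_carrier)
    fix n assume "n \<in> T"
    then show "c n \<odot>\<^bsub>restrict_scalars P'\<^esub> D_tuple K k M r e n = N +>\<^bsub>F\<^esub> (\<lambda>x. c n * De n x)"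
      unfolding D_tuple_eq using T c by (intro restrict_prolongation_smult De_closed) auto
  qed simp
  then show ?thesis
    unfolding restrict_prolongation_finsum P_finsum[OF closed] .
qed

lemma prolongation_basis: "Kbar_t_basis K P' R (D_tuple K k M r e)"
  unfolding Kbar_t_basis_def is_basis_def generates_def linearly_independent_def
    restrict_prolongation_carrier restrict_prolongation_zero ring_on_simps
proof (intro conjI allI impI ballI)
  show D: "D_tuple K k M r e \<in> {..<R} \<rightarrow> carrier P"
    using De_closed by (auto simp: D_tuple_eq P_carrier)
  show "D_tuple K k M r e \<in> {..<R} \<rightarrow> carrier P" by (rule D)
next
  fix Y assume "Y \<in> carrier P"
  then obtain f where f: "f \<in> carrier F" and Y: "Y = N +>\<^bsub>F\<^esub> f" by (auto simp: P_carrier)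
  obtain c where c: "c \<in> {..<R} \<rightarrow> S" and fc: "f - (\<Sum>n<R. (\<lambda>x. c n * De n x)) \<in> N"
    using De_generate[OF f] .
  have "(\<Sum>n<R. (\<lambda>x. c n * De n x)) \<in> carrier F"
    using c by (intro F_sum funcsetI smult_De_closed) auto
  then have "Y = N +>\<^bsub>F\<^esub> (\<Sum>n<R. (\<lambda>x. c n * De n x))"
    unfolding Y by (rule coset_eq[OF f _ fc])
  then show "\<exists>T c. finite T \<and> T \<subseteq> {..<R} \<and> c \<in> T \<rightarrow> S \<and>
      Y = (\<Oplus>\<^bsub>restrict_scalars P'\<^esub>i\<in>T. c i \<odot>\<^bsub>restrict_scalars P'\<^esub> D_tuple K k M r e i)"
    using D_tuple_combination[OF order_refl c] c
    by (intro exI[of _ "{..<R}"] exI[of _ c] conjI) (simp_all only: finite_lessThan order_refl)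
next
  fix T c n
  assume "finite T \<and> T \<subseteq> {..<R} \<and> c \<in> T \<rightarrow> S \<and>
      (\<Oplus>\<^bsub>restrict_scalars P'\<^esub>i\<in>T. c i \<odot>\<^bsub>restrict_scalars P'\<^esub> D_tuple K k M r e i) = N"
    and n: "n \<in> T"
  then have T: "finite T" "T \<subseteq> {..<R}" and c: "c \<in> T \<rightarrow> S"
    and eq: "N +>\<^bsub>F\<^esub> (\<Sum>n\<in>T. (\<lambda>x. c n * De n x)) = N"
    using D_tuple_combination by blast+
  have "(\<Sum>n\<in>T. (\<lambda>x. c n * De n x)) \<in> carrier F"
    using T c by (intro F_sum funcsetI smult_De_closed) auto
  then have "(\<Sum>n\<in>T. (\<lambda>x. c n * De n x)) \<in> N"
    using Q.coset_eq_kernel_iff eq by blast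
  then show "c n = 0" by (rule De_independent[OF T c _ n])
qed

text \<open>\<open>\<sigma>(D\<^sub>i e\<^sub>b) = D\<^sub>i(\<sigma> e\<^sub>b)\<close>, and expanding the latter by \<open>D_comb_expand\<close> gives as coefficients the
  hyperderivatives of the \<open>b\<close>-th column of \<open>\<Theta>\<close>, which form a column of \<open>\<rho>\<^sub>[\<^sub>k\<^sub>](\<Theta>)\<close>.\<close>

lemma prolongation_sigma_matrix:
  assumes \<Theta>: "sigma_matrix K M r e \<Theta>"
  shows "sigma_matrix K P' R (D_tuple K k M r e) (rho k \<Theta>)"
  unfolding sigma_matrix_def
proof (intro conjI allI impI)
  have carrier: "\<Theta> \<in> carrier_mat r r" and elems: "elements_mat \<Theta> \<subseteq> S"
    and sig: "\<And>j. j < r \<Longrightarrow> sigma M (e j) = comb (\<lambda>h. \<Theta> $$ (h, j))"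
    using \<Theta> by (simp_all add: sigma_matrix_def comb_def)
  show "rho k \<Theta> \<in> carrier_mat R R" by (rule rho_carrier[OF carrier])
  show "elements_mat (rho k \<Theta>) \<subseteq> S"
    by (rule rho_elements[OF carrier elems S_closed(1) Kbar_t_hyperderiv])
  fix j assume j: "j < R"
  define i b where "i = j div r" and "b = j mod r"
  have i: "i \<le> k" and b: "b < r" using block_index_less[OF j] by (simp_all add: i_def b_def)
  define c where "c = (\<lambda>h. \<Theta> $$ (h, b))"
  have c: "c \<in> {..<r} \<rightarrow> S"
    unfolding c_def by (intro funcsetI elements_mat_subsetD[OF elems carrier] b) simp
  have sum_closed: "(\<Sum>n<R. (\<lambda>x. hyper_coords i c n * De n x)) \<in> carrier F"
    using hyper_coords_closed[OF c] by (intro F_sum funcsetI smult_De_closed) auto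
  have "sigma P' (D_tuple K k M r e j) = N +>\<^bsub>F\<^esub> D_symbol i (comb c)"
    unfolding D_tuple_eq sigma_prolongation[OF De_closed[OF j]]
    using symbols_sigma_D_symbol[OF i e_closed[OF b]] sig[OF b] by (simp add: De_def i_def b_def c_def)
  also have "\<dots> = N +>\<^bsub>F\<^esub> (\<Sum>n<R. (\<lambda>x. hyper_coords i c n * De n x))"
    by (rule coset_eq[OF D_symbol_closed[OF i comb_closed[OF c]] sum_closed D_comb_expand[OF i c]])
  also have "\<dots> = N +>\<^bsub>F\<^esub> (\<Sum>n<R. (\<lambda>x. rho k \<Theta> $$ (n, j) * De n x))"
  proof -
    have "hyper_coords i c n = rho k \<Theta> $$ (n, j)" if "n < R" for n
      unfolding rho_index[OF carrier that j] by (simp add: hyper_coords_def c_def i_def b_def)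
    then show ?thesis by simp
  qed
  also have "\<dots> = (\<Oplus>\<^bsub>restrict_scalars P'\<^esub>h\<in>{..<R}. rho k \<Theta> $$ (h, j) \<odot>\<^bsub>restrict_scalars P'\<^esub> D_tuple K k M r e h)"
  proof (rule D_tuple_combination[symmetric, OF order_refl])
    show "(\<lambda>h. rho k \<Theta> $$ (h, j)) \<in> {..<R} \<rightarrow> S"
      by (intro funcsetI elements_mat_subsetD[OF rho_elements[OF carrier elems S_closed(1) Kbar_t_hyperderiv]
            rho_carrier[OF carrier]] j) simp_all
  qed
  finally show "sigma P' (D_tuple K k M r e j) =
    (\<Oplus>\<^bsub>restrict_scalars P'\<^esub>h\<in>{..<R}. rho k \<Theta> $$ (h, j) \<odot>\<^bsub>restrict_scalars P'\<^esub> D_tuple K k M r e h)" .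
qed

text \<open>Apply \<open>\<rho>\<^sub>[\<^sub>k\<^sub>]\<close> to \<open>\<Psi> \<Theta> = \<Psi>\<^sup>\<sigma>\<close>: it is multiplicative and commutes with twisting.\<close>

lemma prolongation_trivialization:
  assumes "rigid_analytic_trivialization q K absv M r e \<Psi>"
  shows "rigid_analytic_trivialization q K absv P' R (D_tuple K k M r e) (rho k \<Psi>)"
proof -
  obtain \<Theta> where \<Theta>: "sigma_matrix K M r e \<Theta>" and GL: "\<Psi> \<in> GL r (tate_algebra absv)"
    and eq: "\<Psi> * \<Theta> = map_mat (twist q) \<Psi>"
    using assms unfolding rigid_analytic_trivialization_def by blast
  have \<Psi>: "\<Psi> \<in> carrier_mat r r" "elements_mat \<Psi> \<subseteq> range fps_to_fls"
    using GL order_trans[OF _ tate_algebra_power_series] by (auto simp only: GL_def)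
  have \<Theta>': "\<Theta> \<in> carrier_mat r r" "elements_mat \<Theta> \<subseteq> range fps_to_fls"
    using \<Theta> order_trans[OF _ Kbar_t_power_series] by (auto simp only: sigma_matrix_def)
  have "rho k \<Psi> * rho k \<Theta> = map_mat (twist q) (rho k \<Psi>)"
    unfolding rho_mult[OF \<Psi> \<Theta>', symmetric] eq by (rule rho_twist[OF \<Psi>])
  moreover have "rho k \<Psi> \<in> GL R (tate_algebra absv)"
    by (rule rho_GL[OF GL tate_algebra_power_series zero_in_tate_algebra tate_algebra_hyperderiv])
  ultimately show ?thesis
    unfolding rigid_analytic_trivialization_def
    using prolongation_basis prolongation_sigma_matrix[OF \<Theta>] by blast
qed

end

theorem proposition4p2:
  fixes q :: nat and Fq :: "'c::field set" and \<theta> :: 'c and K :: "'c set"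
    and absv :: "'c \<Rightarrow> real"
    and M :: "('c fls poly, 'm) module" and r :: nat and e :: "nat \<Rightarrow> 'm"
    and \<Theta> :: "'c fls mat" and k :: nat
  assumes "function_field_setting q Fq \<theta> K absv"
    and "dual_t_motive q \<theta> K M"
    and "t_finite K M"
    and "Kbar_t_basis K M r e"
    and "sigma_matrix K M r e \<Theta>"
  shows "Kbar_t_basis K (prolongation q K k M) (r * (k + 1)) (D_tuple K k M r e)
    \<and> sigma_matrix K (prolongation q K k M) (r * (k + 1)) (D_tuple K k M r e) (rho k \<Theta>)
    \<and> (\<forall>\<Psi>. rigid_analytic_trivialization q K absv M r e \<Psi> \<longrightarrow>
          rigid_analytically_trivial q K absv (prolongation q K k M)
          \<and> rigid_analytic_trivialization q K absv (prolongation q K k M)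
               (r * (k + 1)) (D_tuple K k M r e) (rho k \<Psi>))"
proof -
  interpret prolonged_module_basis q Fq \<theta> K absv M k r e
    using assms(1,2,4) unfolding dual_t_motive_def
    by (intro prolonged_module_basis.intro prolonged_module.intro prolonged_module_axioms.intro
        prolonged_module_basis_axioms.intro) blast+
  show ?thesis
    using prolongation_basis prolongation_sigma_matrix[OF assms(5)] prolongation_trivialization
    unfolding rigid_analytically_trivial_def by blast
qed

end
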